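(* Let $K$ be a field, let $v_1,\ldots,v_s\in\mathbb{Z}^n$, and let $P\subset S=K[t_1,\ldots,t_s]$ be the toric ideal of $K[x^{v_1},\ldots,x^{v_s}]\subset K[x_1^{\pm1},\ldots,x_n^{\pm1}]$. Let $A$ be the $n\times s$ matrix with column vectors $v_1,\ldots,v_s$ and let $r$ be the rank of $A$. Then $$|T(\mathbb{Z}^n/\langle v_1,\ldots,v_s\rangle)|\,\deg(S/P)=r!\,{\rm vol}({\rm conv}(v_1,\ldots,v_s,0)).$$
   Context: The toric ideal of $K[x^{v_1},\ldots,x^{v_s}]$ is the kernel of the $K$-algebra epimorphism $S\to K[x^{v_1},\ldots,x^{v_s}]$, $t_i\mapsto x^{v_i}$ (it need not be homogeneous). $\langle v_1,\ldots,v_s\rangle$ is the subgroup of $\mathbb{Z}^n$ generated by the $v_i$, and $T(M)$ is the torsion subgroup of an abelian group $M$. ${\rm conv}$ denotes convex hull in $\mathbb{R}^n$ and, for a lattice polytope $\mathcal{P}$, ${\rm vol}(\mathcal{P})$ is its relative volume, i.e. its volume in its affine span, normalized so that a fundamental domain of the lattice of integer points of that affine span has volume $1$. For an ideal $I\subset S$ with $k=\dim(S/I)$ (Krull dimension), the degree is $\deg(S/I)=k!\lim_{i\to\infty}\dim_K(S_{\le i}/I_{\le i})/i^k$, where $S_{\le i}$ (resp. $I_{\le i}$) is the space of polynomials of $S$ (resp. of $I$) of standard total degree at most $i$. *)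

theory Defs
  imports "HOL-Analysis.Analysis" "HOL-Library.Poly_Mapping" "HOL-Library.Extended_Nat"
    "HOL-Algebra.QuotRing" "HOL-Algebra.Generated_Groups" "HOL-Algebra.Algebraic_Closure_Type"
begin

section \<open>Polynomials and Laurent polynomials\<close>

text \<open>
  With its convolution product, \<open>'a \<Rightarrow>\<^sub>0 'k\<close> is the monoid algebra over \<open>'k\<close> of the additive monoid
  \<open>'a\<close>. So \<open>('s, 'k) mpoly\<close> is the polynomial ring over \<open>'k\<close> in variables indexed by the finite type
  \<open>'s\<close>, and \<open>('n, 'k) laurent\<close> is the Laurent polynomial ring in variables indexed by \<open>'n\<close>, where
  \<open>single a 1\<close> is the monomial with exponent vector \<open>a\<close>.
\<close>

type_synonym ('s, 'k) mpoly = "('s \<Rightarrow>\<^sub>0 nat) \<Rightarrow>\<^sub>0 'k"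
type_synonym ('n, 'k) laurent = "(int ^ 'n) \<Rightarrow>\<^sub>0 'k"

text \<open>The homomorphism of algebras over \<open>'k\<close> that sends the variable with index \<open>i\<close> to the monomial
  with exponent \<open>v i\<close>. Its image is the monomial subring generated by these monomials, so its kernel
  is the toric ideal of that subring.\<close>

definition toric_map :: "('s::finite \<Rightarrow> int ^ 'n) \<Rightarrow> ('s, 'k::field) mpoly \<Rightarrow> ('n, 'k) laurent" where
  "toric_map v f =
     (\<Sum>m\<in>Poly_Mapping.keys f.
        Poly_Mapping.single 0 (Poly_Mapping.lookup f m) *
        (\<Prod>i\<in>UNIV. Poly_Mapping.single (v i) 1 ^ Poly_Mapping.lookup m i))"

definition toric_ideal :: "('s::finite \<Rightarrow> int ^ 'n) \<Rightarrow> ('s, 'k::field) mpoly set" where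
  "toric_ideal v = {f. toric_map v f = 0}"

section \<open>Krull dimension and degree\<close>

definition krull_dim :: "('a, 'b) ring_scheme \<Rightarrow> enat" where
  "krull_dim R =
     Sup {enat m | m. \<exists>Q. (\<forall>i\<le>m. primeideal (Q i) R) \<and> (\<forall>i<m. Q i \<subset> Q (Suc i))}"

definition polys_upto :: "nat \<Rightarrow> ('s::finite, 'k::field) mpoly set" where
  "polys_upto d = {f. \<forall>m\<in>Poly_Mapping.keys f. (\<Sum>i\<in>UNIV. Poly_Mapping.lookup m i) \<le> d}"

text \<open>\<open>quot_basis V W B\<close>: the classes of the elements of the finite set \<open>B\<close> are pairwise distinct and
  form a basis of the vector space \<open>V / W\<close> over \<open>'k\<close>. The factor \<open>single 0 a\<close> is the constant
  polynomial \<open>a\<close>.\<close>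

definition quot_basis ::
    "('s::finite, 'k::field) mpoly set \<Rightarrow> ('s, 'k) mpoly set \<Rightarrow> ('s, 'k) mpoly set \<Rightarrow> bool" where
  "quot_basis V W B \<longleftrightarrow> finite B \<and> B \<subseteq> V \<and>
     (\<forall>f\<in>V. \<exists>!c. c \<in> B \<rightarrow>\<^sub>E UNIV \<and> f - (\<Sum>b\<in>B. Poly_Mapping.single 0 (c b) * b) \<in> W)"

definition quot_dim :: "('s::finite, 'k::field) mpoly set \<Rightarrow> ('s, 'k) mpoly set \<Rightarrow> nat" where
  "quot_dim V W = card (SOME B. quot_basis V W B)"

text \<open>The degree of the quotient of the polynomial ring by the ideal \<open>I\<close>.\<close>

definition deg_quot :: "('s::finite, 'k::field) mpoly set \<Rightarrow> real" where
  "deg_quot I =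
     (let k = the_enat (krull_dim (ring_of_type_algebra Quot I))
      in fact k * lim (\<lambda>i. real (quot_dim (polys_upto i) (I \<inter> polys_upto i)) / real i ^ k))"

section \<open>Torsion\<close>

definition int_vec_group :: "(int ^ 'n) monoid" where
  "int_vec_group = \<lparr>carrier = UNIV, monoid.mult = (+), one = 0\<rparr>"

definition torsion_part :: "('a, 'b) monoid_scheme \<Rightarrow> 'a set" where
  "torsion_part G = {x \<in> carrier G. \<exists>m::nat. m > 0 \<and> x [^]\<^bsub>G\<^esub> m = \<one>\<^bsub>G\<^esub>}"

section \<open>Relative volume\<close>

definition real_vec :: "int ^ 'n \<Rightarrow> real ^ 'n" where
  "real_vec a = (\<chi> i. real_of_int (a $ i))"

definition affine_coords ::
    "nat \<Rightarrow> real ^ 'n \<Rightarrow> (nat \<Rightarrow> real ^ 'n) \<Rightarrow> (nat \<Rightarrow> real) \<Rightarrow> real ^ 'n" where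
  "affine_coords d p b c = p + (\<Sum>i<d. c i *\<^sub>R b i)"

text \<open>\<open>lattice_frame C d p b\<close>: the affine map with origin \<open>p\<close> and axes \<open>b 0, \<dots>, b (d - 1)\<close> identifies
  real \<open>d\<close>-space (functions on \<open>{..<d}\<close>) with the affine span of \<open>C\<close>, and the integer points of
  \<open>d\<close>-space with the lattice of integer points of that affine span.\<close>

definition lattice_frame ::
    "(real ^ 'n) set \<Rightarrow> nat \<Rightarrow> real ^ 'n \<Rightarrow> (nat \<Rightarrow> real ^ 'n) \<Rightarrow> bool" where
  "lattice_frame C d p b \<longleftrightarrow>
     bij_betw (affine_coords d p b) ({..<d} \<rightarrow>\<^sub>E UNIV) (affine hull C) \<and>
     affine_coords d p b ` ({..<d} \<rightarrow>\<^sub>E \<int>) = affine hull C \<inter> range real_vec"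

text \<open>The relative volume is Lebesgue measure in such coordinates: the unit cube then corresponds to
  a fundamental domain of the lattice, which gets volume 1. The value does not depend on the
  frame, as two frames differ by a unimodular affine map; a frame exists whenever \<open>C\<close> is a nonempty
  set of the form \<open>convex hull\<close> of integer points. A single integer point has relative volume 1.\<close>

definition rel_vol :: "(real ^ 'n) set \<Rightarrow> real" where
  "rel_vol C =
     (let d = nat (aff_dim C);
          (p, b) = (SOME (p, b). lattice_frame C d p b)
      in measure (\<Pi>\<^sub>M i\<in>{..<d}. lborel) {c \<in> {..<d} \<rightarrow>\<^sub>E UNIV. affine_coords d p b c \<in> C})"

end

theory Submission
  imports Defs
begin

text \<open>
  Let \<open>N(t)\<close> be the number of distinct sums \<open>\<Sum> m\<^sub>i v\<^sub>i\<close> with \<open>m\<^sub>i \<ge> 0\<close> and \<open>\<Sum> m\<^sub>i \<le> t\<close>. Monomials with these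
  exponents form a basis of the image of the polynomials of degree at most \<open>t\<close>, so \<open>N\<close> is the affine
  Hilbert function of \<open>S/P\<close>. Let \<open>L\<close> be the lattice of integer points of the real span \<open>V\<close> of the
  \<open>v\<^sub>i\<close>, and \<open>G\<close> the subgroup that they generate, so that the torsion group is \<open>L/G\<close>. Write a point of
  \<open>L\<close> in \<open>t conv(v\<^sub>1, \<dots>, v\<^sub>s, 0)\<close> as a real combination of the \<open>v\<^sub>i\<close> and round the coefficients down:
  what remains lies in a finite set. Hence, up to replacing \<open>t\<close> by \<open>t + D\<close> with a constant \<open>D\<close>, the number
  \<open>|L/G| N(t)\<close> equals the number of lattice points of the dilated polytope, which by comparison with
  unit cubes equals its volume \<open>t\<^sup>r vol\<close>. So \<open>|L/G| N(t) / t\<^sup>r\<close> tends to the volume.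

  For the Krull dimension, a chain of \<open>m + 1\<close> primes over \<open>P\<close> forces \<open>N(e t)\<close> to be at least
  \<open>(t + m) choose m\<close> for some constant \<open>e\<close>, so \<open>m \<le> r\<close>. A chain with \<open>m = r\<close> is given by the kernels of
  the maps to the group algebras of the quotients \<open>\<int>\<^sup>k\<close>, \<open>k = r, \<dots>, 0\<close>, of \<open>L\<close>.
\<close>

section \<open>Push-forward of monoid algebra elements\<close>

text \<open>The map of monoid algebras induced by a map \<open>h\<close> of exponents; for additive
  \<open>h\<close> it is multiplicative. The toric map and the coordinate projections used later all
  have this form.\<close>

definition push :: "('a \<Rightarrow> 'b) \<Rightarrow> ('a \<Rightarrow>\<^sub>0 'k::comm_monoid_add) \<Rightarrow> 'b \<Rightarrow>\<^sub>0 'k" where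
  "push h f = (\<Sum>m\<in>Poly_Mapping.keys f. Poly_Mapping.single (h m) (Poly_Mapping.lookup f m))"

lemma push_superset:
  assumes "finite S" "Poly_Mapping.keys f \<subseteq> S"
  shows "push h f = (\<Sum>m\<in>S. Poly_Mapping.single (h m) (Poly_Mapping.lookup f m))"
  unfolding push_def using assms
  by (intro sum.mono_neutral_left) (auto simp: in_keys_iff)

lemma push_0 [simp]: "push h 0 = 0"
  by (simp add: push_def)

lemma push_single [simp]: "push h (Poly_Mapping.single m c) = Poly_Mapping.single (h m) c"
  by (simp add: push_def)

lemma push_add: "push h (f + g) = push h f + push h g"
proof -
  let ?X = "Poly_Mapping.keys f \<union> Poly_Mapping.keys g"
  have "push h (f + g) = (\<Sum>m\<in>?X. Poly_Mapping.single (h m) (Poly_Mapping.lookup (f + g) m))"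
    by (rule push_superset) (use keys_add[of f g] in auto)
  also have "\<dots> = push h f + push h g"
    by (simp add: push_superset[of ?X] lookup_add single_add sum.distrib)
  finally show ?thesis .
qed

lemma push_sum: "push h (sum F A) = (\<Sum>x\<in>A. push h (F x))"
  by (induction A rule: infinite_finite_induct) (auto simp: push_add)

lemma push_minus: "push h (- f) = - push h (f :: 'a \<Rightarrow>\<^sub>0 'k::ab_group_add)"
  using push_add[of h f "- f"] by (simp add: eq_neg_iff_add_eq_0 add.commute)

lemma push_diff: "push h (f - g) = push h f - push h (g :: 'a \<Rightarrow>\<^sub>0 'k::ab_group_add)"
  using push_add[of h f "- g"] by (simp add: push_minus)

lemma sum_single_lookup:
  "(\<Sum>m\<in>Poly_Mapping.keys f. Poly_Mapping.single m (Poly_Mapping.lookup f m)) = f"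
proof (rule poly_mapping_eqI)
  fix k
  have "Poly_Mapping.lookup (\<Sum>m\<in>Poly_Mapping.keys f. Poly_Mapping.single m (Poly_Mapping.lookup f m)) k
      = (\<Sum>m\<in>Poly_Mapping.keys f. if m = k then Poly_Mapping.lookup f m else 0)"
    by (simp add: lookup_sum lookup_single when_def)
  also have "\<dots> = Poly_Mapping.lookup f k"
    by (simp add: in_keys_iff)
  finally show "Poly_Mapping.lookup (\<Sum>m\<in>Poly_Mapping.keys f. Poly_Mapping.single m (Poly_Mapping.lookup f m)) k
      = Poly_Mapping.lookup f k" .
qed

lemma push_push: "push g (push h f) = push (g \<circ> h) f"
  unfolding push_def[of h] push_def[of "g \<circ> h"] by (simp add: push_sum)

lemma push_mult:
  fixes f g :: "'a::monoid_add \<Rightarrow>\<^sub>0 'k::semiring_0"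
  assumes "\<And>x y. h (x + y) = h x + h y"
  shows "push h (f * g) = push h f * push h g"
proof -
  have "push h (f * g) = push h
    ((\<Sum>m\<in>Poly_Mapping.keys f. Poly_Mapping.single m (Poly_Mapping.lookup f m)) *
     (\<Sum>m\<in>Poly_Mapping.keys g. Poly_Mapping.single m (Poly_Mapping.lookup g m)))"
    by (simp only: sum_single_lookup)
  also have "\<dots> = push h f * push h g"
    unfolding sum_product push_sum push_def[of h f] push_def[of h g]
    by (simp add: mult_single assms)
  finally show ?thesis .
qed

lemma keys_push: "Poly_Mapping.keys (push h f) \<subseteq> h ` Poly_Mapping.keys f"
proof -
  have "Poly_Mapping.keys (push h f)
      \<subseteq> (\<Union>m\<in>Poly_Mapping.keys f. Poly_Mapping.keys (Poly_Mapping.single (h m) (Poly_Mapping.lookup f m)))"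
    unfolding push_def by (rule keys_sum)
  then show ?thesis by (auto split: if_splits)
qed

text \<open>Scalars act through constant polynomials, the convention of \<open>quot_basis\<close>,
  so results on span and independence apply directly to the sums that occur there.\<close>

interpretation pm: vector_space "\<lambda>(a::'k::field) (f::'a::monoid_add \<Rightarrow>\<^sub>0 'k). Poly_Mapping.single 0 a * f"
  by unfold_locales (auto simp: algebra_simps single_add mult_single simp flip: mult.assoc)

lemma pm_span_monomials:
  fixes f :: "'a::monoid_add \<Rightarrow>\<^sub>0 'k::field"
  assumes "Poly_Mapping.keys f \<subseteq> S"
  shows "f \<in> pm.span ((\<lambda>x. Poly_Mapping.single x 1) ` S)"
proof -
  have "(\<Sum>m\<in>Poly_Mapping.keys f. Poly_Mapping.single 0 (Poly_Mapping.lookup f m) * Poly_Mapping.single m 1)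
      \<in> pm.span ((\<lambda>x. Poly_Mapping.single x 1) ` S)"
    using assms by (intro pm.span_sum pm.span_scale pm.span_base) auto
  then show ?thesis
    by (simp add: mult_single sum_single_lookup)
qed

lemma inj_single_one: "inj_on (\<lambda>x. Poly_Mapping.single x (1::'k::zero_neq_one)) S"
proof (rule inj_onI)
  fix x y assume "Poly_Mapping.single x (1::'k) = Poly_Mapping.single y 1"
  then have "Poly_Mapping.keys (Poly_Mapping.single x (1::'k)) = Poly_Mapping.keys (Poly_Mapping.single y (1::'k))"
    by (rule arg_cong)
  then show "x = y" by simp
qed

text \<open>The coefficient at \<open>x\<close> of a linear combination isolates the scalar in front
  of \<open>single x 1\<close>.\<close>

lemma pm_independent_monomials:
  "pm.independent ((\<lambda>x::'a::monoid_add. Poly_Mapping.single x (1::'k::field)) ` S)"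
  unfolding pm.independent_explicit_module
proof (intro allI impI)
  fix t u and w :: "'a \<Rightarrow>\<^sub>0 'k"
  assume t: "finite t" "t \<subseteq> (\<lambda>x. Poly_Mapping.single x 1) ` S"
    and eq: "(\<Sum>w\<in>t. Poly_Mapping.single 0 (u w) * w) = 0" and w: "w \<in> t"
  obtain x where x: "w = Poly_Mapping.single x 1" using t w by auto
  have "0 = Poly_Mapping.lookup (\<Sum>w\<in>t. Poly_Mapping.single 0 (u w) * w) x"
    by (simp add: eq)
  also have "\<dots> = (\<Sum>w'\<in>t. if w' = w then u w' else 0)"
    unfolding lookup_sum
  proof (intro sum.cong refl)
    fix w' assume "w' \<in> t"
    then obtain y where "w' = Poly_Mapping.single y 1" using t by auto
    then show "Poly_Mapping.lookup (Poly_Mapping.single 0 (u w') * w') x = (if w' = w then u w' else 0)"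
      using x inj_single_one[of UNIV, where ?'k = 'k]
      by (auto simp: mult_single lookup_single when_def inj_on_def)
  qed
  also have "\<dots> = u w" using t w by simp
  finally show "u w = 0" by simp
qed

section \<open>The Hilbert function of a toric ideal\<close>

text \<open>The exponent of the Laurent monomial to which the toric map sends the monomial with
  exponents \<open>m\<close>.\<close>

definition expo :: "('s::finite \<Rightarrow> int ^ 'n) \<Rightarrow> ('s \<Rightarrow>\<^sub>0 nat) \<Rightarrow> int ^ 'n" where
  "expo v m = (\<Sum>i\<in>UNIV. int (Poly_Mapping.lookup m i) *s v i)"

definition tdeg :: "('s::finite \<Rightarrow>\<^sub>0 nat) \<Rightarrow> nat" where
  "tdeg m = (\<Sum>i\<in>UNIV. Poly_Mapping.lookup m i)"

text \<open>The cardinality of this set is the number \<open>N(t)\<close> of the overview.\<close>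

definition expos_upto :: "('s::finite \<Rightarrow> int ^ 'n) \<Rightarrow> nat \<Rightarrow> (int ^ 'n) set" where
  "expos_upto v t = expo v ` {m. tdeg m \<le> t}"

lemma expo_add: "expo v (x + y) = expo v x + expo v y"
  by (simp add: expo_def lookup_add vector_sadd_rdistrib sum.distrib)

lemma expo_0 [simp]: "expo v 0 = 0"
  by (simp add: expo_def)

lemma tdeg_add: "tdeg (x + y) = tdeg x + tdeg y"
  by (simp add: tdeg_def lookup_add sum.distrib)

lemma finite_tdeg_le: "finite {m :: 's::finite \<Rightarrow>\<^sub>0 nat. tdeg m \<le> t}"
proof (rule finite_imageD)
  have "Poly_Mapping.lookup m i \<le> t" if "tdeg m \<le> t" for m :: "'s \<Rightarrow>\<^sub>0 nat" and i
    using member_le_sum[of i UNIV "Poly_Mapping.lookup m"] that by (simp add: tdeg_def)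
  then have "Poly_Mapping.lookup ` {m :: 's \<Rightarrow>\<^sub>0 nat. tdeg m \<le> t} \<subseteq> UNIV \<rightarrow>\<^sub>E {..t}"
    by auto
  then show "finite (Poly_Mapping.lookup ` {m :: 's \<Rightarrow>\<^sub>0 nat. tdeg m \<le> t})"
    by (rule finite_subset) (auto intro: finite_PiE)
  show "inj_on Poly_Mapping.lookup {m :: 's \<Rightarrow>\<^sub>0 nat. tdeg m \<le> t}"
    by (auto simp: inj_on_def poly_mapping_eqI)
qed

lemma finite_expos_upto: "finite (expos_upto v t)"
  unfolding expos_upto_def by (intro finite_imageI finite_tdeg_le)

lemma polys_upto_iff: "f \<in> polys_upto t \<longleftrightarrow> Poly_Mapping.keys f \<subseteq> {m. tdeg m \<le> t}"
  by (auto simp: polys_upto_def tdeg_def)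

lemma single_power:
  "Poly_Mapping.single (a::int^'n) (1::'k::comm_semiring_1) ^ k = Poly_Mapping.single (int k *s a) 1"
  by (induction k) (auto simp: mult_single vector_sadd_rdistrib single_one)

lemma prod_single:
  "(\<Prod>i\<in>A. Poly_Mapping.single (F i :: 'a::comm_monoid_add) (1::'k::comm_semiring_1))
     = Poly_Mapping.single (\<Sum>i\<in>A. F i) 1"
  by (induction A rule: infinite_finite_induct) (auto simp: mult_single single_one)

lemma toric_map_eq_push: "toric_map v f = push (expo v) f"
  unfolding toric_map_def push_def
  by (simp add: single_power prod_single expo_def mult_single)

lemma mem_toric_ideal: "f \<in> toric_ideal v \<longleftrightarrow> push (expo v) f = 0"
  by (simp add: toric_ideal_def toric_map_eq_push)

lemma push_scale:
  fixes h :: "'a::monoid_add \<Rightarrow> 'b::monoid_add" and b :: "'a \<Rightarrow>\<^sub>0 'k::field"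
  assumes "\<And>x y. h (x + y) = h x + h y" "h 0 = 0"
  shows "push h (Poly_Mapping.single 0 c * b) = Poly_Mapping.single 0 c * push h b"
  by (simp add: push_mult assms)

text \<open>Linear independence of the classes modulo \<open>J\<close>, expressed on
  representatives. It forces distinct elements of \<open>B\<close> to have distinct classes, so
  \<open>card B\<close> counts independent classes.\<close>

definition indep_mod :: "('a::monoid_add \<Rightarrow>\<^sub>0 'k::field) set \<Rightarrow> ('a \<Rightarrow>\<^sub>0 'k) set \<Rightarrow> bool" where
  "indep_mod J B \<longleftrightarrow>
     finite B \<and> (\<forall>c. (\<Sum>b\<in>B. Poly_Mapping.single 0 (c b) * b) \<in> J \<longrightarrow> (\<forall>b\<in>B. c b = 0))"

text \<open>The toric map has kernel \<open>toric_ideal v\<close>, so it keeps \<open>B\<close>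
  independent; the images lie in the span of the monomials with exponents in
  \<open>expos_upto v t\<close>.\<close>

lemma indep_mod_card_le:
  fixes v :: "'s::finite \<Rightarrow> int ^ 'n" and B :: "('s, 'k::field) mpoly set"
  assumes B: "indep_mod (toric_ideal v) B" "B \<subseteq> polys_upto t"
  shows "card B \<le> card (expos_upto v t)"
proof -
  let ?p = "push (expo v) :: ('s, 'k) mpoly \<Rightarrow> ('n, 'k) laurent"
  have fin: "finite B" using B by (simp add: indep_mod_def)
  have dep: "\<forall>b\<in>B. c b = 0" if "(\<Sum>b\<in>B. Poly_Mapping.single 0 (c b) * ?p b) = 0" for c
  proof -
    have "(\<Sum>b\<in>B. Poly_Mapping.single 0 (c b) * b) \<in> toric_ideal v"
      using that by (simp add: mem_toric_ideal push_sum push_scale expo_add)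
    then show ?thesis using B by (auto simp: indep_mod_def)
  qed
  have inj: "inj_on ?p B"
  proof (rule inj_onI, rule ccontr)
    fix x y assume xy: "x \<in> B" "y \<in> B" "?p x = ?p y" "x \<noteq> y"
    \<comment> \<open>Two elements with the same image would give the relation \<open>x - y\<close>
      with nonzero coefficients.\<close>
    let ?c = "\<lambda>b. if b = x then 1 else if b = y then - 1 else (0::'k)"
    have "(\<Sum>b\<in>B. Poly_Mapping.single 0 (?c b) * ?p b)
        = (\<Sum>b\<in>{x,y}. Poly_Mapping.single 0 (?c b) * ?p b)"
      using fin xy by (intro sum.mono_neutral_right) auto
    also have "\<dots> = 0"
      using xy by (simp add: single_uminus single_one)
    finally have "\<forall>b\<in>B. ?c b = 0" by (rule dep)
    then show False using xy by auto
  qed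
  have ind: "pm.independent (?p ` B)"
    unfolding pm.independent_explicit_finite_subsets
  proof (intro allI impI ballI)
    fix A u w
    assume A: "A \<subseteq> ?p ` B" "finite A" "(\<Sum>v\<in>A. Poly_Mapping.single 0 (u v) * v) = 0" "w \<in> A"
    \<comment> \<open>Extension by zero: \<open>dep\<close> speaks of sums over all of
      \<open>B\<close>, the relation only of the subset \<open>A\<close>.\<close>
    let ?u = "\<lambda>w. if w \<in> A then u w else 0"
    have "(\<Sum>b\<in>B. Poly_Mapping.single 0 (?u (?p b)) * ?p b)
       = (\<Sum>w\<in>?p ` B. Poly_Mapping.single 0 (?u w) * w)"
      using inj by (simp add: sum.reindex)
    also have "\<dots> = (\<Sum>w\<in>A. Poly_Mapping.single 0 (u w) * w)"
      using A fin by (intro sum.mono_neutral_cong_right) auto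
    finally have "\<forall>b\<in>B. ?u (?p b) = 0" using A by (intro dep) auto
    then show "u w = 0" using A by force
  qed
  have "?p ` B \<subseteq> pm.span ((\<lambda>x. Poly_Mapping.single x 1) ` expos_upto v t)"
  proof
    fix g assume "g \<in> ?p ` B"
    then obtain b where b: "b \<in> B" "g = ?p b" by auto
    have "Poly_Mapping.keys g \<subseteq> expos_upto v t"
      using keys_push[of "expo v" b] b B(2) polys_upto_iff[of b t]
      unfolding expos_upto_def by blast
    then show "g \<in> pm.span ((\<lambda>x. Poly_Mapping.single x 1) ` expos_upto v t)"
      by (rule pm_span_monomials)
  qed
  then have "card (?p ` B) \<le> card ((\<lambda>x. Poly_Mapping.single x (1::'k)) ` expos_upto v t)"
    by (rule conjunct2[OF pm.independent_span_bound[OF finite_imageI[OF finite_expos_upto] ind]])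
  then show ?thesis
    by (simp add: card_image inj inj_single_one)
qed

text \<open>Uniqueness of the coefficients, applied to the zero polynomial, gives independence and
  hence one inequality; their existence, applied to monomials, shows that the images span, which
  gives the other.\<close>

lemma quot_basis_card:
  fixes v :: "'s::finite \<Rightarrow> int ^ 'n" and B :: "('s, 'k::field) mpoly set"
  assumes "quot_basis (polys_upto t) (toric_ideal v \<inter> polys_upto t) B"
  shows "card B = card (expos_upto v t)"
proof (rule antisym)
  let ?p = "push (expo v) :: ('s, 'k) mpoly \<Rightarrow> ('n, 'k) laurent"
  let ?W = "toric_ideal v \<inter> polys_upto t :: ('s, 'k) mpoly set"
  have fin: "finite B" and BV: "B \<subseteq> polys_upto t"
    and ex1: "\<And>f. f \<in> polys_upto t \<Longrightarrow> \<exists>!c. c \<in> B \<rightarrow>\<^sub>E UNIV \<and>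
        f - (\<Sum>b\<in>B. Poly_Mapping.single 0 (c b) * b) \<in> ?W"
    using assms by (auto simp: quot_basis_def)
  have sumB: "(\<Sum>b\<in>B. Poly_Mapping.single 0 (c b) * b) \<in> polys_upto t" for c
  proof -
    have "Poly_Mapping.keys (\<Sum>b\<in>B. Poly_Mapping.single 0 (c b) * b)
      \<subseteq> (\<Union>b\<in>B. Poly_Mapping.keys (Poly_Mapping.single 0 (c b) * b))"
      by (rule keys_sum)
    also have "\<dots> \<subseteq> (\<Union>b\<in>B. Poly_Mapping.keys b)"
    proof (rule UN_mono)
      fix b show "Poly_Mapping.keys (Poly_Mapping.single 0 (c b) * b) \<subseteq> Poly_Mapping.keys b"
        using keys_mult[of "Poly_Mapping.single 0 (c b)" b] by (auto split: if_splits)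
    qed auto
    also have "\<dots> \<subseteq> {m. tdeg m \<le> t}"
      using BV unfolding polys_upto_iff[symmetric] UN_subset_iff by blast
    finally show ?thesis by (simp only: polys_upto_iff)
  qed
  have "indep_mod (toric_ideal v) B"
    unfolding indep_mod_def
  proof (intro conjI allI impI ballI fin)
    fix c :: "('s, 'k) mpoly \<Rightarrow> 'k" and b
    assume c: "(\<Sum>b\<in>B. Poly_Mapping.single 0 (c b) * b) \<in> toric_ideal v" and b: "b \<in> B"
    \<comment> \<open>Two representations of 0 modulo the ideal; since they must coincide,
      \<open>c\<close> vanishes on \<open>B\<close>. The restriction to \<open>B\<close> makes both
      functions extensional, as uniqueness concerns only such functions.\<close>
    let ?c = "\<lambda>b\<in>B. - c b" and ?z = "\<lambda>b\<in>B. (0::'k)"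
    have 0: "0 \<in> polys_upto t" by (simp add: polys_upto_def)
    have "0 - (\<Sum>b\<in>B. Poly_Mapping.single 0 (?c b) * b) = (\<Sum>b\<in>B. Poly_Mapping.single 0 (c b) * b)"
      by (simp add: single_uminus sum_negf)
    then have c': "0 - (\<Sum>b\<in>B. Poly_Mapping.single 0 (?c b) * b) \<in> ?W"
      using c sumB by simp
    have z': "0 - (\<Sum>b\<in>B. Poly_Mapping.single 0 (?z b) * b) \<in> ?W"
      using 0 by (simp add: mem_toric_ideal)
    have E: "?c \<in> B \<rightarrow>\<^sub>E UNIV" "?z \<in> B \<rightarrow>\<^sub>E UNIV" by auto
    from ex1[OF 0] obtain c0 where c0:
      "\<And>c. c \<in> B \<rightarrow>\<^sub>E UNIV \<Longrightarrow> 0 - (\<Sum>b\<in>B. Poly_Mapping.single 0 (c b) * b) \<in> ?W \<Longrightarrow> c = c0"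
      by (elim ex1E) (iprover intro: conjI)
    have "?c = c0" "?z = c0" by (rule c0[OF E(1) c'], rule c0[OF E(2) z'])
    then have "?c = ?z" by (rule trans[OF _ sym])
    then show "c b = 0" using b by (metis neg_equal_0_iff_equal restrict_apply')
  qed
  then show "card B \<le> card (expos_upto v t)"
    using BV by (rule indep_mod_card_le)
  \<comment> \<open>Each of these Laurent monomials lifts to a monomial of degree at most
    \<open>t\<close>, which is a combination of \<open>B\<close> modulo the ideal.\<close>
  have "(\<lambda>x. Poly_Mapping.single x (1::'k)) ` expos_upto v t \<subseteq> pm.span (?p ` B)"
  proof
    fix g assume "g \<in> (\<lambda>x. Poly_Mapping.single x (1::'k)) ` expos_upto v t"
    then obtain m where m: "tdeg m \<le> t" "g = Poly_Mapping.single (expo v m) 1"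
      by (auto simp: expos_upto_def)
    have "Poly_Mapping.single m 1 \<in> polys_upto t"
      using m by (simp add: polys_upto_iff)
    then obtain c where "Poly_Mapping.single m 1 - (\<Sum>b\<in>B. Poly_Mapping.single 0 (c b) * b) \<in> ?W"
      using ex1 by blast
    then have "g = (\<Sum>b\<in>B. Poly_Mapping.single 0 (c b) * ?p b)"
      using m by (simp add: mem_toric_ideal push_sum push_scale expo_add push_diff)
    moreover have "(\<Sum>b\<in>B. Poly_Mapping.single 0 (c b) * ?p b) \<in> pm.span (?p ` B)"
      by (intro pm.span_sum pm.span_scale pm.span_base imageI)
    ultimately show "g \<in> pm.span (?p ` B)" by simp
  qed
  then have "card ((\<lambda>x. Poly_Mapping.single x (1::'k)) ` expos_upto v t) \<le> card (?p ` B)"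
    by (rule conjunct2[OF pm.independent_span_bound[OF finite_imageI[OF fin] pm_independent_monomials]])
  also have "\<dots> \<le> card B" by (rule card_image_le[OF fin])
  finally show "card (expos_upto v t) \<le> card B"
    by (simp add: card_image inj_single_one)
qed

text \<open>Choosing one monomial of degree at most \<open>t\<close> over each exponent gives a
  basis. Existence guarantees that the choice in \<open>quot_dim\<close> picks a genuine
  basis.\<close>

lemma quot_basis_exists:
  fixes v :: "'s::finite \<Rightarrow> int ^ 'n"
  shows "\<exists>B :: ('s, 'k::field) mpoly set.
    quot_basis (polys_upto t) (toric_ideal v \<inter> polys_upto t) B"
proof -
  define s where "s u = (SOME m. tdeg m \<le> t \<and> expo v m = u)" for u
  have s: "tdeg (s u) \<le> t" "expo v (s u) = u" if "u \<in> expos_upto v t" for u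
    using that someI_ex[of "\<lambda>m. tdeg m \<le> t \<and> expo v m = u"] unfolding s_def expos_upto_def by auto
  define e :: "int^'n \<Rightarrow> ('s, 'k) mpoly" where "e u = Poly_Mapping.single (s u) 1" for u
  let ?X = "expos_upto v t"
  have inj_e: "inj_on e ?X"
  proof (rule inj_onI)
    fix u w assume uw: "u \<in> ?X" "w \<in> ?X" "e u = e w"
    from uw(3) have "Poly_Mapping.single (s u) (1::'k) = Poly_Mapping.single (s w) 1"
      by (simp only: e_def)
    then have "s u = s w" by (rule inj_onD[OF inj_single_one]) (rule UNIV_I)+
    then show "u = w" using s(2) uw by metis
  qed
  have push_comb: "push (expo v) (\<Sum>b\<in>e ` ?X. Poly_Mapping.single 0 (c b) * b)
     = (\<Sum>u\<in>?X. Poly_Mapping.single u (c (e u)))" for c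
    by (simp add: sum.reindex[OF inj_e] push_sum) (simp add: e_def mult_single s)
  have eV: "e u \<in> polys_upto t" if "u \<in> ?X" for u
    using s[OF that] by (simp add: e_def polys_upto_iff)
  have "quot_basis (polys_upto t) (toric_ideal v \<inter> polys_upto t) (e ` ?X)"
    unfolding quot_basis_def
  proof (intro conjI ballI)
    show "finite (e ` ?X)" by (simp add: finite_expos_upto)
    show "e ` ?X \<subseteq> polys_upto t" using eV by auto
    fix f :: "('s, 'k) mpoly" assume f: "f \<in> polys_upto t"
    have keys: "Poly_Mapping.keys (push (expo v) f) \<subseteq> ?X"
      using keys_push[of "expo v" f] f unfolding polys_upto_iff expos_upto_def by blast
    have diff_V: "f - (\<Sum>b\<in>e ` ?X. Poly_Mapping.single 0 (c b) * b) \<in> polys_upto t" for c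
    proof -
      have "Poly_Mapping.keys (\<Sum>b\<in>e ` ?X. Poly_Mapping.single 0 (c b) * b)
         \<subseteq> (\<Union>b\<in>e ` ?X. Poly_Mapping.keys (Poly_Mapping.single 0 (c b) * b))"
        by (rule keys_sum)
      also have "\<dots> \<subseteq> {m. tdeg m \<le> t}"
        using s by (auto simp: e_def mult_single split: if_splits)
      finally show ?thesis
        using f keys_diff[of f "\<Sum>b\<in>e ` ?X. Poly_Mapping.single 0 (c b) * b"] unfolding polys_upto_iff by blast
    qed
    \<comment> \<open>After applying the toric map, membership is a comparison of coefficients: that
      of \<open>e u\<close> has to be the coefficient of the image of \<open>f\<close> at
      \<open>u\<close>. Existence and uniqueness are then immediate.\<close>
    have iff: "f - (\<Sum>b\<in>e ` ?X. Poly_Mapping.single 0 (c b) * b) \<in> toric_ideal v \<inter> polys_upto t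
        \<longleftrightarrow> (\<forall>u\<in>?X. c (e u) = Poly_Mapping.lookup (push (expo v) f) u)" for c
    proof -
      have lk: "Poly_Mapping.lookup (\<Sum>u\<in>?X. Poly_Mapping.single u (c (e u))) u
          = (if u \<in> ?X then c (e u) else 0)" for u
        by (simp add: lookup_sum lookup_single when_def finite_expos_upto)
      have "f - (\<Sum>b\<in>e ` ?X. Poly_Mapping.single 0 (c b) * b) \<in> toric_ideal v \<inter> polys_upto t
        \<longleftrightarrow> push (expo v) f = (\<Sum>u\<in>?X. Poly_Mapping.single u (c (e u)))"
        using diff_V by (simp add: mem_toric_ideal push_diff push_comb)
      also have "\<dots> \<longleftrightarrow> (\<forall>u\<in>?X. c (e u) = Poly_Mapping.lookup (push (expo v) f) u)"
        using keys unfolding poly_mapping_eq_iff fun_eq_iff lk by (auto simp: in_keys_iff)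
      finally show ?thesis .
    qed
    show "\<exists>!c. c \<in> e ` ?X \<rightarrow>\<^sub>E UNIV \<and>
       f - (\<Sum>b\<in>e ` ?X. Poly_Mapping.single 0 (c b) * b) \<in> toric_ideal v \<inter> polys_upto t"
      unfolding iff
    proof (rule ex1I)
      let ?c = "\<lambda>b\<in>e ` ?X. Poly_Mapping.lookup (push (expo v) f) (the_inv_into ?X e b)"
      show "?c \<in> e ` ?X \<rightarrow>\<^sub>E UNIV \<and> (\<forall>u\<in>?X. ?c (e u) = Poly_Mapping.lookup (push (expo v) f) u)"
        by (simp add: the_inv_into_f_f[OF inj_e])
      fix c assume "c \<in> e ` ?X \<rightarrow>\<^sub>E UNIV \<and> (\<forall>u\<in>?X. c (e u) = Poly_Mapping.lookup (push (expo v) f) u)"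
      then show "c = ?c"
        by (intro ext) (auto simp: the_inv_into_f_f[OF inj_e] PiE_def extensional_def)
    qed
  qed
  then show ?thesis by blast
qed

lemma quot_dim_toric:
  "quot_dim (polys_upto t) (toric_ideal v \<inter> polys_upto t :: ('s::finite, 'k::field) mpoly set)
     = card (expos_upto v t)"
  unfolding quot_dim_def using quot_basis_card someI_ex[OF quot_basis_exists] by metis

section \<open>Krull dimension\<close>

context cring
begin

text \<open>Because \<open>J\<close> contains \<open>I\<close>, a coset belongs to the image of
  \<open>J\<close> exactly when its representatives belong to \<open>J\<close>; primality can thus
  be tested on representatives.\<close>

lemma primeideal_quot_iff:
  assumes I: "ideal I R" and J: "ideal J R" "I \<subseteq> J"
  shows "primeideal ((+>) I ` J) (R Quot I) \<longleftrightarrow> primeideal J R"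
proof -
  have cQ: "cring (R Quot I)"
    by (rule ideal.quotient_is_cring[OF I is_cring])
  have idJ: "ideal ((+>) I ` J) (R Quot I)" and UnJ: "\<Union>((+>) I ` J) = J"
    using quot_ideal_correspondence[OF I] ideal_incl_iff[OF I J(1)] J
    by (auto simp: bij_betw_def)
  have mem: "I +> a \<in> (+>) I ` J \<longleftrightarrow> a \<in> J" if "a \<in> carrier R" for a
    using canonical_proj_vimage_mem_iff[OF I _ that, of "(+>) I ` J"] UnJ
      additive_subgroup.a_subset[OF ideal.axioms(1)[OF idJ]] by simp
  have car: "carrier (R Quot I) = (+>) I ` carrier R"
    by (auto simp: FactRing_simps)
  have mult: "(I +> a) \<otimes>\<^bsub>R Quot I\<^esub> (I +> b) = I +> (a \<otimes> b)"
    if "a \<in> carrier R" "b \<in> carrier R" for a b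
    using ideal.rcoset_mult_add[OF I that] by (simp add: FactRing_def)
  have JC: "J \<subseteq> carrier R" by (rule additive_subgroup.a_subset[OF ideal.axioms(1)[OF J(1)]])
  have full: "carrier (R Quot I) = (+>) I ` J \<longleftrightarrow> carrier R = J"
    unfolding car using mem JC by blast
  show ?thesis
  proof
    assume "primeideal ((+>) I ` J) (R Quot I)"
    then interpret p: primeideal "(+>) I ` J" "R Quot I" .
    show "primeideal J R"
    proof (rule primeidealI[OF J(1) is_cring])
      show "carrier R \<noteq> J" using p.I_notcarr full by blast
      fix a b assume ab: "a \<in> carrier R" "b \<in> carrier R" "a \<otimes> b \<in> J"
      then have "(I +> a) \<otimes>\<^bsub>R Quot I\<^esub> (I +> b) \<in> (+>) I ` J"
        by (simp add: mult)
      then have "I +> a \<in> (+>) I ` J \<or> I +> b \<in> (+>) I ` J"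
        using p.I_prime[of "I +> a" "I +> b"] ab car by blast
      then show "a \<in> J \<or> b \<in> J" using mem ab by blast
    qed
  next
    assume "primeideal J R"
    then interpret p: primeideal J R .
    show "primeideal ((+>) I ` J) (R Quot I)"
    proof (rule primeidealI[OF idJ cQ])
      show "carrier (R Quot I) \<noteq> (+>) I ` J" using p.I_notcarr full by blast
      fix x y assume xy: "x \<in> carrier (R Quot I)" "y \<in> carrier (R Quot I)"
        "x \<otimes>\<^bsub>R Quot I\<^esub> y \<in> (+>) I ` J"
      then obtain a b where ab: "a \<in> carrier R" "x = I +> a" "b \<in> carrier R" "y = I +> b"
        unfolding car by blast
      then have "a \<otimes> b \<in> J" using xy mult mem by simp
      then show "x \<in> (+>) I ` J \<or> y \<in> (+>) I ` J"
        using p.I_prime[of a b] ab by blast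
    qed
  qed
qed

text \<open>The correspondence between primes of the quotient and primes containing \<open>I\<close>
  preserves strict inclusions, hence chains.\<close>

lemma krull_dim_quot:
  assumes I: "ideal I R"
  shows "krull_dim (R Quot I) = Sup {enat m | m. \<exists>Q. (\<forall>i\<le>m. primeideal (Q i) R \<and> I \<subseteq> Q i) \<and>
            (\<forall>i<m. Q i \<subset> Q (Suc i))}"
proof -
  have "(\<exists>Q. (\<forall>i\<le>m. primeideal (Q i) (R Quot I)) \<and> (\<forall>i<m. Q i \<subset> Q (Suc i))) \<longleftrightarrow>
     (\<exists>Q. (\<forall>i\<le>m. primeideal (Q i) R \<and> I \<subseteq> Q i) \<and> (\<forall>i<m. Q i \<subset> Q (Suc i)))" (is "?L \<longleftrightarrow> ?R") for m
  proof
    assume ?L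
    then obtain Q where Q: "\<forall>i\<le>m. primeideal (Q i) (R Quot I)" "\<forall>i<m. Q i \<subset> Q (Suc i)" by blast
    \<comment> \<open>The union of the cosets in \<open>Q i\<close> is the preimage of
      \<open>Q i\<close> in \<open>R\<close>.\<close>
    define J where "J i = \<Union>(Q i)" for i
    have J: "ideal (J i) R \<and> I \<subseteq> J i \<and> Q i = (+>) I ` J i" if "i \<le> m" for i
    proof -
      have "Q i \<in> {J. ideal J (R Quot I)}" using Q(1) that primeideal.axioms(1) by blast
      then obtain K where K: "ideal K R" "I \<subseteq> K" "Q i = (+>) I ` K"
        using bij_betw_imp_surj_on[OF quot_ideal_correspondence[OF I]] by blast
      moreover have "J i = K" unfolding J_def K(3) using ideal_incl_iff[OF I K(1)] K(2) by simp
      ultimately show ?thesis by simp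
    qed
    have "primeideal (J i) R \<and> I \<subseteq> J i" if "i \<le> m" for i
      using primeideal_quot_iff[OF I, of "J i"] J[OF that] Q(1) that by metis
    moreover have "J i \<subset> J (Suc i)" if "i < m" for i
    proof
      have sub: "Q i \<subset> Q (Suc i)" using Q(2) that by blast
      then show "J i \<subseteq> J (Suc i)" unfolding J_def by (intro Union_mono) (rule psubset_imp_subset)
      have "Q i = (+>) I ` J i" "Q (Suc i) = (+>) I ` J (Suc i)"
        using J[of i] J[of "Suc i"] that by simp_all
      with sub show "J i \<noteq> J (Suc i)" by (metis psubset_eq)
    qed
    ultimately show ?R by blast
  next
    assume ?R
    then obtain Q where Q: "\<forall>i\<le>m. primeideal (Q i) R \<and> I \<subseteq> Q i" "\<forall>i<m. Q i \<subset> Q (Suc i)" by blast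
    have idl: "ideal (Q i) R" if "i \<le> m" for i using Q(1) that primeideal.axioms(1) by blast
    have "primeideal ((+>) I ` Q i) (R Quot I)" if "i \<le> m" for i
      using primeideal_quot_iff[OF I idl[OF that]] Q(1) that by blast
    moreover have "(+>) I ` Q i \<subset> (+>) I ` Q (Suc i)" if "i < m" for i
    proof
      show "(+>) I ` Q i \<subseteq> (+>) I ` Q (Suc i)" using Q(2) that by blast
      have "\<Union>((+>) I ` Q j) = Q j" if "j \<le> m" for j
        using ideal_incl_iff[OF I idl[OF that]] Q(1) that by auto
      from this[of i] this[of "Suc i"] show "(+>) I ` Q i \<noteq> (+>) I ` Q (Suc i)"
        using Q(2) that by (metis Suc_leI less_imp_le psubsetE)
    qed
    ultimately show ?L by (intro exI[of _ "\<lambda>i. (+>) I ` Q i"]) blast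
  qed
  then show ?thesis unfolding krull_dim_def by simp
qed

end

section \<open>Ideals and primes in terms of type class operations\<close>

lemma ring_of_type_simps [simp]:
  "carrier (ring_of_type_algebra :: 'a::comm_ring_1 ring) = UNIV"
  "x \<otimes>\<^bsub>ring_of_type_algebra\<^esub> y = x * (y :: 'a)"
  "x \<oplus>\<^bsub>ring_of_type_algebra\<^esub> y = x + (y :: 'a)"
  "\<one>\<^bsub>ring_of_type_algebra\<^esub> = (1 :: 'a)"
  "\<zero>\<^bsub>ring_of_type_algebra\<^esub> = (0 :: 'a)"
  by (auto simp: ring_of_type_algebra_def)

lemma ideal_type_iff:
  "ideal I (ring_of_type_algebra :: 'a::comm_ring_1 ring) \<longleftrightarrow>
     0 \<in> I \<and> (\<forall>x\<in>I. \<forall>y\<in>I. x + y \<in> I) \<and> (\<forall>x\<in>I. \<forall>r. r * x \<in> I)"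
proof
  interpret R: cring "ring_of_type_algebra :: 'a ring" by (rule cring_from_type_algebra)
  assume "ideal I (ring_of_type_algebra :: 'a ring)"
  then interpret i: ideal I "ring_of_type_algebra :: 'a ring" .
  show "0 \<in> I \<and> (\<forall>x\<in>I. \<forall>y\<in>I. x + y \<in> I) \<and> (\<forall>x\<in>I. \<forall>r. r * x \<in> I)"
    using i.zero_closed i.a_closed i.I_l_closed by simp
next
  interpret R: cring "ring_of_type_algebra :: 'a ring" by (rule cring_from_type_algebra)
  assume I: "0 \<in> I \<and> (\<forall>x\<in>I. \<forall>y\<in>I. x + y \<in> I) \<and> (\<forall>x\<in>I. \<forall>r. r * x \<in> I)"
  have uminus: "\<ominus>\<^bsub>ring_of_type_algebra\<^esub> x = - x" for x :: 'a
    using R.minus_equality[of "- x" x] by simp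
  show "ideal I (ring_of_type_algebra :: 'a ring)"
  proof (rule idealI)
    show "ring (ring_of_type_algebra :: 'a ring)" by (rule R.ring_axioms)
    show "subgroup I (add_monoid (ring_of_type_algebra :: 'a ring))"
    proof (rule R.add.subgroupI)
      show "I \<noteq> {}" using I by blast
      fix a assume "a \<in> I"
      then have "(- 1) * a \<in> I" using I by blast
      then show "\<ominus>\<^bsub>ring_of_type_algebra\<^esub> a \<in> I" by (simp add: uminus)
    qed (use I in auto)
  qed (use I in \<open>auto simp: mult.commute\<close>)
qed

lemma primeideal_type_iff:
  "primeideal I (ring_of_type_algebra :: 'a::comm_ring_1 ring) \<longleftrightarrow>
     ideal I (ring_of_type_algebra :: 'a::comm_ring_1 ring) \<and> 1 \<notin> I \<and>
     (\<forall>x y. x * y \<in> I \<longrightarrow> x \<in> I \<or> y \<in> I)"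
proof
  assume "primeideal I (ring_of_type_algebra :: 'a ring)"
  then interpret p: primeideal I "ring_of_type_algebra :: 'a ring" .
  show "ideal I (ring_of_type_algebra :: 'a::comm_ring_1 ring) \<and> 1 \<notin> I \<and>
     (\<forall>x y. x * y \<in> I \<longrightarrow> x \<in> I \<or> y \<in> I)"
    using p.ideal_axioms p.I_prime p.one_imp_carrier p.I_notcarr by auto
next
  assume I: "ideal I (ring_of_type_algebra :: 'a::comm_ring_1 ring) \<and> 1 \<notin> I \<and>
     (\<forall>x y. x * y \<in> I \<longrightarrow> x \<in> I \<or> y \<in> I)"
  show "primeideal I (ring_of_type_algebra :: 'a ring)"
    by (rule primeidealI) (use I cring_from_type_algebra in auto)
qed

text \<open>The codomain is a domain, so a product with zero image has a factor with zero image;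
  \<open>\<phi> 1 = 1\<close> keeps the kernel proper.\<close>

lemma primeideal_kernel:
  fixes \<phi> :: "'a::comm_ring_1 \<Rightarrow> 'b::idom"
  assumes "\<And>x y. \<phi> (x + y) = \<phi> x + \<phi> y" "\<And>x y. \<phi> (x * y) = \<phi> x * \<phi> y" "\<phi> 1 = 1"
  shows "primeideal {x. \<phi> x = 0} ring_of_type_algebra"
proof -
  have "\<phi> 0 = 0" using assms(1)[of 0 0] by (metis add.right_neutral add_left_cancel)
  then show ?thesis unfolding primeideal_type_iff ideal_type_iff
    using assms by auto
qed

section \<open>Chains of primes and growth of the quotient\<close>

lemma polys_upto_mult:
  assumes "f \<in> polys_upto a" "g \<in> polys_upto b"
  shows "f * g \<in> polys_upto (a + b)"
  unfolding polys_upto_iff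
proof
  fix m assume "m \<in> Poly_Mapping.keys (f * g)"
  then obtain x y where "m = x + y" "x \<in> Poly_Mapping.keys f" "y \<in> Poly_Mapping.keys g"
    using keys_mult[of f g] by blast
  then show "m \<in> {m. tdeg m \<le> a + b}"
    using assms by (auto simp: polys_upto_iff tdeg_add intro!: add_mono)
qed

lemma polys_upto_mono: "a \<le> b \<Longrightarrow> polys_upto a \<subseteq> polys_upto b"
  by (auto simp: polys_upto_def)

lemma ex_polys_upto: "\<exists>a. f \<in> polys_upto a"
proof
  \<comment> \<open>For \<open>f = 0\<close> the value of \<open>Max\<close> on the empty set is
    harmless, as there are no keys to bound.\<close>
  show "f \<in> polys_upto (Max (tdeg ` Poly_Mapping.keys f))"
    by (auto simp: polys_upto_iff)
qed

lemma indep_mod_subset: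
  "indep_mod J B \<Longrightarrow> J' \<subseteq> J \<Longrightarrow> indep_mod J' B"
  unfolding indep_mod_def by blast

lemma indep_modD:
  "indep_mod J B \<Longrightarrow> (\<Sum>b\<in>B. Poly_Mapping.single 0 (c b) * b) \<in> J \<Longrightarrow> b \<in> B \<Longrightarrow> c b = 0"
  unfolding indep_mod_def by blast

lemma indep_mod_not_mem:
  assumes "indep_mod J B" "b \<in> B"
  shows "b \<notin> J"
proof
  assume "b \<in> J"
  moreover have "(\<Sum>b'\<in>B. Poly_Mapping.single 0 (if b' = b then 1 else 0) * b') = b"
  proof -
    have "(\<Sum>b'\<in>B. Poly_Mapping.single 0 (if b' = b then 1 else 0) * b') = (\<Sum>b'\<in>B. if b' = b then b' else 0)"
      by (intro sum.cong) (auto simp: single_one)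
    then show ?thesis using assms by (simp add: indep_mod_def)
  qed
  ultimately show False
    using indep_modD[OF assms(1) _ assms(2), of "\<lambda>b'. if b' = b then 1 else 0"] by simp
qed

lemma indep_mod_diff_not_mem:
  assumes "indep_mod J B" "b \<in> B" "b' \<in> B" "b \<noteq> b'"
  shows "b - b' \<notin> J"
proof
  assume "b - b' \<in> J"
  let ?c = "\<lambda>x. if x = b then 1 else if x = b' then - 1 else 0"
  have "(\<Sum>x\<in>B. Poly_Mapping.single 0 (?c x) * x) = (\<Sum>x\<in>{b, b'}. Poly_Mapping.single 0 (?c x) * x)"
    using assms by (intro sum.mono_neutral_right) (auto simp: indep_mod_def)
  also have "\<dots> = b - b'"
    using assms by (simp add: single_uminus single_one)
  finally show False
    using indep_modD[OF assms(1) _ assms(2), of ?c] \<open>b - b' \<in> J\<close> by simp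
qed

text \<open>The growth of the quotient drops by one order when the prime \<open>J\<close> is replaced by a larger
  ideal: multiplication by \<open>f \<in> J' - J\<close> is injective modulo \<open>J\<close> and has image in \<open>J'\<close>.\<close>

lemma indep_mod_extend:
  fixes J J' :: "('s::finite, 'k::field) mpoly set"
  assumes J: "primeideal J ring_of_type_algebra" and J': "ideal J' ring_of_type_algebra"
    and sub: "J \<subseteq> J'" and f: "f \<in> J'" "f \<notin> J"
    and B: "indep_mod J B" and B': "indep_mod J' B'"
  shows "indep_mod J (B' \<union> (*) f ` B)" "card (B' \<union> (*) f ` B) = card B' + card B"
proof -
  have fin: "finite B" "finite B'" using B B' by (auto simp: indep_mod_def)
  have Jp: "y \<in> J" if "f * y \<in> J" for y
    using J f(2) that by (auto simp: primeideal_type_iff)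
  have fJ': "f * y \<in> J'" for y
    using J' f(1) unfolding ideal_type_iff by (metis mult.commute)
  have inj: "inj_on ((*) f) B"
  proof (rule inj_onI, rule ccontr)
    fix x y assume xy: "x \<in> B" "y \<in> B" "f * x = f * y" "x \<noteq> y"
    then have "f * (x - y) \<in> J"
      using J by (simp add: algebra_simps primeideal_type_iff ideal_type_iff)
    then show False using indep_mod_diff_not_mem[OF B xy(1,2,4)] Jp by blast
  qed
  \<comment> \<open>Multiples of \<open>f\<close> lie in \<open>J'\<close>, whereas elements
    independent modulo \<open>J'\<close> do not.\<close>
  have disj: "B' \<inter> (*) f ` B = {}"
    using indep_mod_not_mem[OF B'] fJ' by blast
  show "card (B' \<union> (*) f ` B) = card B' + card B"
    using fin disj inj by (simp add: card_Un_disjoint card_image)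
  show "indep_mod J (B' \<union> (*) f ` B)"
    unfolding indep_mod_def
  proof (intro conjI allI impI)
    show "finite (B' \<union> (*) f ` B)" using fin by simp
    fix c :: "('s, 'k) mpoly \<Rightarrow> 'k"
    let ?s1 = "\<Sum>b\<in>B'. Poly_Mapping.single 0 (c b) * b"
    let ?s2 = "\<Sum>b\<in>B. Poly_Mapping.single 0 (c (f * b)) * b"
    assume "(\<Sum>b\<in>B' \<union> (*) f ` B. Poly_Mapping.single 0 (c b) * b) \<in> J"
    also have "(\<Sum>b\<in>B' \<union> (*) f ` B. Poly_Mapping.single 0 (c b) * b) = ?s1 + f * ?s2"
      using fin disj
      by (simp add: sum.union_disjoint sum.reindex[OF inj] sum_distrib_left mult.left_commute)
    finally have sJ: "?s1 + f * ?s2 \<in> J" .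
    \<comment> \<open>Modulo \<open>J'\<close> only the part from \<open>B'\<close> survives, so its
      coefficients vanish first. Primality of \<open>J\<close> then cancels \<open>f\<close> from
      the rest.\<close>
    then have "(?s1 + f * ?s2) + (- 1) * (f * ?s2) \<in> J'"
      using J' sub fJ' unfolding ideal_type_iff by blast
    then have "?s1 \<in> J'" by simp
    then have c1: "\<forall>b\<in>B'. c b = 0" using indep_modD[OF B', of c] by blast
    then have "?s1 = 0" by simp
    then have "?s2 \<in> J" using sJ Jp by simp
    then have c2: "\<forall>b\<in>B. c (f * b) = 0" using indep_modD[OF B, of "\<lambda>b. c (f * b)"] by blast
    show "\<forall>b\<in>B' \<union> (*) f ` B. c b = 0" using c1 c2 by blast
  qed
qed

text \<open>Pascal's rule: the independent set for \<open>(t, m)\<close> is the union of the one for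
  \<open>(t, m - 1)\<close> along the chain starting at \<open>Q 1\<close> and \<open>f 0\<close>
  times the one for \<open>(t - 1, m)\<close>. Each multiplication by some \<open>f i\<close> raises
  the degree by at most \<open>e\<close>, hence the bound \<open>e * t\<close>.\<close>

lemma prime_chain_indep:
  fixes Q :: "nat \<Rightarrow> ('s::finite, 'k::field) mpoly set"
  assumes "\<And>i. i \<le> m \<Longrightarrow> primeideal (Q i) ring_of_type_algebra"
    and "\<And>i. i < m \<Longrightarrow> f i \<in> Q (Suc i) \<and> f i \<notin> Q i \<and> f i \<in> polys_upto e"
    and "\<And>i. i < m \<Longrightarrow> Q i \<subseteq> Q (Suc i)"
  shows "\<exists>B. indep_mod (Q 0) B \<and> B \<subseteq> polys_upto (e * t) \<and> card B = (t + m) choose m"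
  using assms
proof (induction "t + m" arbitrary: t m Q f rule: less_induct)
  case less
  \<comment> \<open>For \<open>m = 0\<close> or \<open>t = 0\<close> the binomial coefficient is 1,
    and a proper ideal contains no nonzero constant.\<close>
  have one: "\<exists>B. indep_mod (Q 0) B \<and> B \<subseteq> polys_upto (e * t) \<and> card B = 1"
  proof (intro exI[of _ "{1}"] conjI)
    have nQ: "1 \<notin> Q 0" using less.prems(1)[of 0] by (simp add: primeideal_type_iff)
    show "indep_mod (Q 0) {1}"
      unfolding indep_mod_def
    proof (intro conjI allI impI ballI)
      fix c :: "('s, 'k) mpoly \<Rightarrow> 'k" and b :: "('s, 'k) mpoly"
      assume c: "(\<Sum>b\<in>{1}. Poly_Mapping.single 0 (c b) * b) \<in> Q 0" and b: "b \<in> {1}"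
      show "c b = 0"
      proof (rule ccontr)
        assume "c b \<noteq> 0"
        have "Poly_Mapping.single 0 (inverse (c b)) * Poly_Mapping.single 0 (c b) \<in> Q 0"
          using less.prems(1)[of 0] c b by (simp add: primeideal_type_iff ideal_type_iff)
        then show False using nQ \<open>c b \<noteq> 0\<close> by (simp add: mult_single single_one)
      qed
    qed auto
    show "{1} \<subseteq> polys_upto (e * t)" by (simp add: polys_upto_iff tdeg_def)
  qed simp
  show ?case
  proof (cases m)
    case 0
    then show ?thesis using one by simp
  next
    case m: (Suc m')
    show ?thesis
    proof (cases t)
      case 0
      then show ?thesis using one by simp
    next
      case t: (Suc t')
      have "\<exists>B. indep_mod (Q 0) B \<and> B \<subseteq> polys_upto (e * t') \<and> card B = (t' + m) choose m"
        by (rule less.hyps) (use t less.prems in auto)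
      then obtain B where B: "indep_mod (Q 0) B" "B \<subseteq> polys_upto (e * t')" "card B = (t' + m) choose m"
        by blast
      have "\<exists>B. indep_mod (Q (Suc 0)) B \<and> B \<subseteq> polys_upto (e * t) \<and> card B = (t + m') choose m'"
        by (rule less.hyps[of t m' "\<lambda>i. Q (Suc i)" "\<lambda>i. f (Suc i)"]) (use m less.prems in auto)
      then obtain B' where B': "indep_mod (Q (Suc 0)) B'" "B' \<subseteq> polys_upto (e * t)"
        "card B' = (t + m') choose m'"
        by blast
      have Q: "primeideal (Q 0) ring_of_type_algebra" "primeideal (Q (Suc 0)) ring_of_type_algebra"
        using less.prems(1)[of 0] less.prems(1)[of "Suc 0"] m by auto
      note ext = indep_mod_extend[OF Q(1) primeideal.axioms(1)[OF Q(2)] _ _ _ B(1) B'(1), of "f 0"]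
      show ?thesis
      proof (intro exI[of _ "B' \<union> (*) (f 0) ` B"] conjI)
        show "indep_mod (Q 0) (B' \<union> (*) (f 0) ` B)"
          by (rule ext) (use m less.prems in auto)
        have "card (B' \<union> (*) (f 0) ` B) = card B' + card B"
          by (rule ext) (use m less.prems in auto)
        then show "card (B' \<union> (*) (f 0) ` B) = t + m choose m"
          using m t B B' by simp
        have "f 0 * b \<in> polys_upto (e * t)" if "b \<in> B" for b
          using polys_upto_mult[of "f 0" e b "e * t'"] less.prems(2)[of 0] that m t B(2) by auto
        then show "B' \<union> (*) (f 0) ` B \<subseteq> polys_upto (e * t)" using B'(2) by auto
      qed
    qed
  qed
qed

text \<open>A chain of length \<open>m\<close> yields at least \<open>t^m / m!\<close> independent
  classes in degree \<open>e * t\<close>, which exceeds the assumed order \<open>t^r\<close> for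
  large \<open>t\<close> if \<open>m > r\<close>.\<close>

lemma prime_chain_length_le:
  fixes v :: "'s::finite \<Rightarrow> int ^ 'n" and Q :: "nat \<Rightarrow> ('s, 'k::field) mpoly set"
  assumes growth: "\<And>t. t \<ge> 1 \<Longrightarrow> real (card (expos_upto v t)) \<le> C * real t ^ r"
    and prime: "\<And>i. i \<le> m \<Longrightarrow> primeideal (Q i) ring_of_type_algebra \<and> toric_ideal v \<subseteq> Q i"
    and mono: "\<And>i. i < m \<Longrightarrow> Q i \<subset> Q (Suc i)"
  shows "m \<le> r"
proof (rule ccontr)
  assume "\<not> m \<le> r"
  then have mr: "m \<ge> Suc r" by simp
  have "\<exists>f. \<forall>i<m. f i \<in> Q (Suc i) \<and> f i \<notin> Q i"
    using mono by (intro exI[of _ "\<lambda>i. SOME f. f \<in> Q (Suc i) \<and> f \<notin> Q i"]) (metis (mono_tags, lifting) psubset_imp_ex_mem Diff_iff someI_ex)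
  then obtain f where f: "\<And>i. i < m \<Longrightarrow> f i \<in> Q (Suc i) \<and> f i \<notin> Q i" by blast
  obtain d where d: "\<And>i. f i \<in> polys_upto (d i)" using ex_polys_upto[of "f _"] by metis
  \<comment> \<open>A common degree bound for the chosen elements; \<open>Suc\<close> makes
    \<open>e * t\<close> at least 1, as \<open>growth\<close> requires.\<close>
  define e where "e = Suc (\<Sum>i<m. d i)"
  have fe: "f i \<in> polys_upto e" if "i < m" for i
  proof -
    have "d i \<le> (\<Sum>i<m. d i)" using that by (intro member_le_sum) auto
    then show ?thesis using d[of i] polys_upto_mono[of "d i" e] by (auto simp: e_def)
  qed
  define K where "K = C * real e ^ r * fact m"
  have bound: "real t \<le> K" if t: "t \<ge> 1" for t
  proof -
    have "\<exists>B. indep_mod (Q 0) B \<and> B \<subseteq> polys_upto (e * t) \<and> card B = (t + m) choose m"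
      by (rule prime_chain_indep[where f = f]) (use prime f fe psubset_imp_subset[OF mono] in auto)
    then obtain B where B: "indep_mod (Q 0) B" "B \<subseteq> polys_upto (e * t)" "card B = (t + m) choose m"
      by blast
    have "indep_mod (toric_ideal v) B"
      using B(1) prime[of 0] by (auto intro: indep_mod_subset)
    from indep_mod_card_le[OF this B(2)] have "(t + m) choose m \<le> card (expos_upto v (e * t))"
      by (simp add: B(3))
    then have "real ((t + m) choose m) \<le> C * real (e * t) ^ r"
      using growth[of "e * t"] t by (simp add: e_def)
    \<comment> \<open>The binomial coefficient times \<open>m!\<close> is a product of the factors
      \<open>t + m - i\<close> with \<open>i < m\<close>, each at least \<open>t\<close>.\<close>
    moreover have "real t ^ m \<le> fact m * real ((t + m) choose m)"
    proof -
      have "real t ^ m = (\<Prod>i<m. real t)" by simp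
      also have "\<dots> \<le> (\<Prod>i<m. real (t + m) - real i)"
        by (intro prod_mono) auto
      also have "\<dots> = fact m * real ((t + m) choose m)"
        using gbinomial_prod_rev[of "real (t + m)" m] by (simp add: binomial_gbinomial atLeast0LessThan)
      finally show ?thesis .
    qed
    ultimately have "real t ^ m \<le> fact m * (C * real (e * t) ^ r)"
      by (metis (no_types) fact_ge_zero mult_left_mono order_trans)
    also have "\<dots> = K * real t ^ r" by (simp add: K_def power_mult_distrib)
    finally have 1: "real t ^ m \<le> K * real t ^ r" .
    have "real t * real t ^ r \<le> real t ^ m"
      using power_increasing[OF mr, of "real t"] t by simp
    with 1 have "real t * real t ^ r \<le> K * real t ^ r" by linarith
    then show ?thesis using t by (simp add: mult_le_cancel_right)
  qed
  obtain t :: nat where "real t > max K 1" using reals_Archimedean2 by blast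
  then show False using bound[of t] by simp
qed

section \<open>Lattice points of the dilated polytope\<close>

lemma real_vec_nth [simp]: "real_vec x $ i = real_of_int (x $ i)"
  by (simp add: real_vec_def)

lemma real_vec_0 [simp]: "real_vec 0 = 0"
  and real_vec_add: "real_vec (x + y) = real_vec x + real_vec y"
  and real_vec_diff: "real_vec (x - y) = real_vec x - real_vec y"
  and real_vec_smult: "real_vec (c *s x) = real_of_int c *\<^sub>R real_vec x"
  by (simp_all add: vec_eq_iff)

lemma real_vec_sum: "real_vec (sum f A) = (\<Sum>i\<in>A. real_vec (f i))"
  by (induction A rule: infinite_finite_induct) (auto simp: real_vec_add)

lemma real_vec_eq_iff [simp]: "real_vec x = real_vec y \<longleftrightarrow> x = y"
  by (auto simp: vec_eq_iff)

lemma finite_real_vec_bounded: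
  assumes "bounded S"
  shows "finite {x :: int ^ 'n. real_vec x \<in> S}"
proof -
  obtain B where B: "\<And>y. y \<in> S \<Longrightarrow> norm y \<le> B"
    using assms by (auto simp: bounded_iff)
  have "vec_nth ` {x :: int ^ 'n. real_vec x \<in> S} \<subseteq> UNIV \<rightarrow>\<^sub>E {- \<lceil>B\<rceil>..\<lceil>B\<rceil>}"
  proof (intro image_subsetI PiE_I)
    fix x :: "int ^ 'n" and i assume "x \<in> {x. real_vec x \<in> S}"
    then have "\<bar>real_of_int (x $ i)\<bar> \<le> B"
      using B[of "real_vec x"] component_le_norm_cart[of "real_vec x" i] by simp
    then show "x $ i \<in> {- \<lceil>B\<rceil>..\<lceil>B\<rceil>}" by (simp add: abs_le_iff) linarith
  qed auto
  then have "finite (vec_nth ` {x :: int ^ 'n. real_vec x \<in> S})"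
    by (rule finite_subset) (auto intro: finite_PiE)
  then show ?thesis
    by (rule finite_imageD) (auto simp: inj_on_def vec_eq_iff)
qed

section \<open>Bases of subgroups of the integer lattice\<close>

lemma subgroup_smult_closed:
  fixes L :: "(int ^ 'n) set"
  assumes "0 \<in> L" "\<And>x y. x \<in> L \<Longrightarrow> y \<in> L \<Longrightarrow> x - y \<in> L" "x \<in> L"
  shows "c *s x \<in> L"
proof -
  have neg: "- y \<in> L" if "y \<in> L" for y using assms(2)[OF assms(1) that] by simp
  have nat: "int k *s x \<in> L" for k
  proof (induction k)
    case (Suc k)
    have "int (Suc k) *s x = int k *s x - (- x)"
      by (simp add: vec_eq_iff algebra_simps)
    then show ?case using assms(2)[OF Suc neg[OF assms(3)]] by (simp only:)
  qed (use assms in simp)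
  show ?thesis
  proof (cases c rule: int_cases2)
    case (nonneg k) then show ?thesis using nat by simp
  next
    case (nonpos k)
    have "c *s x = - (int k *s x)" using nonpos by (simp add: vec_eq_iff)
    then show ?thesis using neg[OF nat] by simp
  qed
qed

text \<open>Induction on the set \<open>J\<close> of coordinates: a vector whose \<open>j\<close>-th entry generates the group of
  \<open>j\<close>-th entries extends a basis of the subgroup where this entry vanishes.\<close>

lemma subgroup_basis:
  fixes L :: "(int ^ 'n) set"
  assumes "finite J" "0 \<in> L" "\<And>x y. x \<in> L \<Longrightarrow> y \<in> L \<Longrightarrow> x - y \<in> L"
    and "\<And>x i. x \<in> L \<Longrightarrow> i \<notin> J \<Longrightarrow> x $ i = 0"
  shows "\<exists>d b. (\<forall>i<d. b i \<in> L) \<and> (\<forall>x\<in>L. \<exists>c. x = (\<Sum>i<d. c i *s b i)) \<and>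
     (\<forall>c. (\<Sum>i<d. c i *\<^sub>R real_vec (b i)) = 0 \<longrightarrow> (\<forall>i<(d::nat). c i = 0))"
  using assms
proof (induction J arbitrary: L rule: finite_induct)
  case empty
  then have "L = {0}" by (auto simp: vec_eq_iff)
  then show ?case by (intro exI[of _ 0]) auto
next
  case (insert j J)
  let ?L = "{x \<in> L. x $ j = 0}"
  have "\<exists>d b. (\<forall>i<d. b i \<in> ?L) \<and> (\<forall>x\<in>?L. \<exists>c. x = (\<Sum>i<d. c i *s b i)) \<and>
     (\<forall>c. (\<Sum>i<d. c i *\<^sub>R real_vec (b i)) = 0 \<longrightarrow> (\<forall>i<(d::nat). c i = 0))"
  proof (rule insert.IH)
    show "x $ i = 0" if "x \<in> ?L" "i \<notin> J" for x :: "int ^ 'n" and i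
      using insert.prems(3)[of x i] that by (cases "i = j") auto
  qed (use insert.prems(1,2) in auto)
  then obtain d b where b: "\<And>i. i < d \<Longrightarrow> b i \<in> ?L" "\<And>x. x \<in> ?L \<Longrightarrow> \<exists>c. x = (\<Sum>i<d. c i *s b i)"
     "\<And>c i. (\<Sum>i<d. c i *\<^sub>R real_vec (b i)) = 0 \<Longrightarrow> i < (d::nat) \<Longrightarrow> c i = 0" by blast
  have smult: "c *s x \<in> L" if "x \<in> L" for c x
    by (rule subgroup_smult_closed) (use insert.prems(1,2) that in auto)
  show ?case
  proof (cases "L = ?L")
    case True
    have "\<forall>x\<in>L. \<exists>c. x = (\<Sum>i<d. c i *s b i)" using b(2) by (subst True) blast
    then show ?thesis using b(1,3) by (intro exI[of _ d] exI[of _ b]) auto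
  next
    case False
    then obtain x0 where x0: "x0 \<in> L" "x0 $ j \<noteq> 0" by blast
    \<comment> \<open>The least \<open>n\<close> satisfying \<open>Q\<close> will generate the group
      of \<open>j\<close>-th entries; the sign of \<open>x0 $ j\<close> turns a nonzero entry into a
      positive one.\<close>
    define Q where "Q n \<longleftrightarrow> n > 0 \<and> (\<exists>x\<in>L. x $ j = int n)" for n
    have "(sgn (x0 $ j) *s x0) $ j = int (nat \<bar>x0 $ j\<bar>)"
      by (auto simp: sgn_if)
    then have "Q (nat \<bar>x0 $ j\<bar>)"
      unfolding Q_def using x0(2) smult[OF x0(1)] by (intro conjI bexI) auto
    then have Qm: "Q (LEAST n. Q n)" by (rule LeastI)
    define m where "m = (LEAST n. Q n)"
    have m_min: "m \<le> n" if "Q n" for n using that unfolding m_def by (rule Least_le)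
    obtain y where y: "y \<in> L" "y $ j = int m" "m > 0" using Qm unfolding m_def Q_def by blast
    \<comment> \<open>Division with remainder: a nonzero remainder would be a positive entry smaller
      than \<open>m\<close>.\<close>
    have red: "x - (x $ j div int m) *s y \<in> ?L" if x: "x \<in> L" for x
    proof -
      let ?x = "x - (x $ j div int m) *s y"
      have xL: "?x \<in> L" by (intro insert.prems smult x y)
      have xj: "?x $ j = x $ j mod int m" using y by (simp add: minus_div_mult_eq_mod)
      have "x $ j mod int m = 0"
      proof (rule ccontr)
        assume "x $ j mod int m \<noteq> 0"
        then have pos: "x $ j mod int m > 0" using y(3)
          by (metis of_nat_0_less_iff order_le_less pos_mod_sign)
        then have "Q (nat (x $ j mod int m))"
          unfolding Q_def using xL xj by (intro conjI bexI[of _ ?x]) auto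
        from m_min[OF this] show False using pos y(3) pos_mod_bound[of "int m" "x $ j"] by linarith
      qed
      then show ?thesis using xL xj by simp
    qed
    let ?b = "b(d := y)"
    show ?thesis
    proof (intro exI[of _ "Suc d"] exI[of _ ?b] conjI allI impI ballI)
      fix i assume "i < Suc d"
      then show "?b i \<in> L" using b(1)[of i] y by (auto simp: less_Suc_eq)
    next
      fix x assume "x \<in> L"
      from b(2)[OF red[OF this]] obtain c where
        c: "x - (x $ j div int m) *s y = (\<Sum>i<d. c i *s b i)" by blast
      show "\<exists>c. x = (\<Sum>i<Suc d. c i *s ?b i)"
        using c by (intro exI[of _ "c(d := x $ j div int m)"]) (simp add: algebra_simps)
    next
      fix c i assume c: "(\<Sum>i<Suc d. c i *\<^sub>R real_vec (?b i)) = 0" and i: "i < Suc d"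
      have eq: "(\<Sum>i<d. c i *\<^sub>R real_vec (b i)) + c d *\<^sub>R real_vec y = 0" using c by simp
      \<comment> \<open>The old basis vectors vanish at \<open>j\<close>, so the \<open>j\<close>-th
        entry of the relation involves only \<open>c d\<close>.\<close>
      have "((\<Sum>i<d. c i *\<^sub>R real_vec (b i)) + c d *\<^sub>R real_vec y) $ j = c d * real m"
        using b(1) y by (simp add: sum_component)
      then have cd: "c d = 0" using eq y by simp
      then show "c i = 0" using eq b(3)[of c i] i by (auto simp: less_Suc_eq)
    qed
  qed
qed

text \<open>\<open>b\<close> is a basis of the lattice of integer points of the real span of the
  \<open>v i\<close>; real independence makes \<open>d\<close> the dimension of the span as well.
  The basis is a parameter so that the axes of a frame chosen in \<open>rel_vol\<close> can serve as
  \<open>b\<close>.\<close>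

locale lattice_vectors =
  fixes v :: "'s::finite \<Rightarrow> int ^ 'n" and d :: nat and b :: "nat \<Rightarrow> int ^ 'n"
  assumes basis_in: "i < d \<Longrightarrow> real_vec (b i) \<in> span (range (\<lambda>i. real_vec (v i)))"
    and basis_gen: "real_vec x \<in> span (range (\<lambda>i. real_vec (v i))) \<Longrightarrow> \<exists>c. x = (\<Sum>i<d. c i *s b i)"
    and basis_indep: "(\<Sum>i<d. c i *\<^sub>R real_vec (b i)) = 0 \<Longrightarrow> i < d \<Longrightarrow> c i = 0"
begin

section \<open>Real and integral combinations, and the dilated polytope\<close>

definition V :: "(real ^ 'n) set" where
  "V = span (range (\<lambda>i. real_vec (v i)))"

definition comb :: "('s \<Rightarrow> real) \<Rightarrow> real ^ 'n" where
  "comb l = (\<Sum>i\<in>UNIV. l i *\<^sub>R real_vec (v i))"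

definition icomb :: "('s \<Rightarrow> int) \<Rightarrow> int ^ 'n" where
  "icomb z = (\<Sum>i\<in>UNIV. z i *s v i)"

text \<open>For \<open>t > 0\<close> this is the dilate by \<open>t\<close> of the convex hull of 0
  and the \<open>v i\<close>, see \<open>T_1\<close> and \<open>T_eq_scale\<close>. The vertex 0
  takes up the missing weight, hence an inequality for the sum.\<close>

definition T :: "real \<Rightarrow> (real ^ 'n) set" where
  "T t = comb ` {l. (\<forall>i. 0 \<le> l i) \<and> sum l UNIV \<le> t}"

definition L :: "(int ^ 'n) set" where
  "L = {x. real_vec x \<in> V}"

definition LT :: "real \<Rightarrow> (int ^ 'n) set" where
  "LT t = {x. real_vec x \<in> T t}"

definition G :: "(int ^ 'n) set" where
  "G = range icomb"

lemma comb_add: "comb l + comb k = comb (\<lambda>i. l i + k i)"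
  by (simp add: comb_def scaleR_add_left sum.distrib)

lemma comb_diff: "comb l - comb k = comb (\<lambda>i. l i - k i)"
  by (simp add: comb_def scaleR_diff_left sum_subtractf)

lemma comb_scale: "c *\<^sub>R comb l = comb (\<lambda>i. c * l i)"
  by (simp add: comb_def scaleR_sum_right)

lemma comb_sum: "(\<Sum>j\<in>A. comb (l j)) = comb (\<lambda>i. \<Sum>j\<in>A. l j i)"
  by (simp add: comb_def scaleR_sum_left) (rule sum.swap)

lemma icomb_add: "icomb l + icomb k = icomb (\<lambda>i. l i + k i)"
  by (simp add: icomb_def vector_sadd_rdistrib sum.distrib)

lemma icomb_diff: "icomb l - icomb k = icomb (\<lambda>i. l i - k i)"
  by (simp add: icomb_def vec_eq_iff sum_component sum_subtractf algebra_simps)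

lemma real_vec_icomb: "real_vec (icomb z) = comb (\<lambda>i. real_of_int (z i))"
  by (simp add: icomb_def comb_def real_vec_sum real_vec_smult)

lemma V_eq_comb: "V = range comb"
proof
  show "range comb \<subseteq> V"
    unfolding V_def comb_def by (intro image_subsetI span_sum span_scale span_base) auto
  show "V \<subseteq> range comb"
    unfolding V_def
  proof (rule span_minimal)
    have "real_vec (v i) = comb (\<lambda>j. if j = i then 1 else 0)" for i
      by (simp add: comb_def if_distribR if_distrib[of "\<lambda>c. c *\<^sub>R _"] cong: if_cong)
    then show "range (\<lambda>i. real_vec (v i)) \<subseteq> range comb" by (metis image_subsetI rangeI)
    have "0 = comb (\<lambda>_. 0)" by (simp add: comb_def)
    then show "subspace (range comb)"
      by (intro subspaceI) (auto simp: comb_add comb_scale)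
  qed
qed

lemma T_subset_V: "T t \<subseteq> V"
  by (auto simp: T_def V_eq_comb)

lemma T_add: "x \<in> T s \<Longrightarrow> y \<in> T t \<Longrightarrow> x + y \<in> T (s + t)"
  unfolding T_def by (auto simp: comb_add sum.distrib intro!: imageI add_mono)

lemma T_mono: "s \<le> t \<Longrightarrow> T s \<subseteq> T t"
  by (auto simp: T_def)

lemma T_scale: "c > 0 \<Longrightarrow> c *\<^sub>R x \<in> T (c * t) \<longleftrightarrow> x \<in> T t"
proof -
  have *: "c *\<^sub>R x \<in> T (c * t)" if "c > 0" "x \<in> T t" for c x t
  proof -
    obtain l where "x = comb l" "\<forall>i. 0 \<le> l i" "sum l UNIV \<le> t" using \<open>x \<in> T t\<close> by (auto simp: T_def)
    then show ?thesis using \<open>c > 0\<close> unfolding T_def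
      by (intro image_eqI[of _ _ "\<lambda>i. c * l i"]) (auto simp: comb_scale simp flip: sum_distrib_left)
  qed
  assume "c > 0"
  then show ?thesis using *[of c x t] *[of "inverse c" "c *\<^sub>R x" "c * t"] by (auto simp flip: mult.assoc)
qed

lemma zero_in_T: "t \<ge> 0 \<Longrightarrow> 0 \<in> T t"
  unfolding T_def by (intro image_eqI[of _ _ "\<lambda>_. 0"]) (auto simp: comb_def)

lemma convex_T: "convex (T t)"
proof (rule convexI)
  fix x y :: "real ^ 'n" and u w :: real
  assume "x \<in> T t" "y \<in> T t" and u: "0 \<le> u" "0 \<le> w" "u + w = 1"
  then obtain l k where l: "x = comb l" "\<forall>i. 0 \<le> l i" "sum l UNIV \<le> t"
    and k: "y = comb k" "\<forall>i. 0 \<le> k i" "sum k UNIV \<le> t" by (auto simp: T_def)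
  have "u *\<^sub>R x + w *\<^sub>R y = comb (\<lambda>i. u * l i + w * k i)"
    by (simp add: l k comb_scale comb_add)
  moreover have "(\<Sum>i\<in>UNIV. u * l i + w * k i) \<le> u * t + w * t"
    using l k u by (auto simp: sum.distrib simp flip: sum_distrib_left intro!: add_mono mult_left_mono)
  moreover have "u * t + w * t = t" using u by (simp flip: distrib_right)
  ultimately show "u *\<^sub>R x + w *\<^sub>R y \<in> T t"
    unfolding T_def using l k u by (intro image_eqI[of _ _ "\<lambda>i. u * l i + w * k i"]) auto
qed

lemma T_1: "T 1 = convex hull (insert 0 (range (\<lambda>i. real_vec (v i))))"
proof
  have "real_vec (v i) \<in> T 1" for i
    unfolding T_def by (intro image_eqI[of _ _ "\<lambda>j. if j = i then 1 else 0"])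
      (auto simp: comb_def if_distribR if_distrib[of "\<lambda>c. c *\<^sub>R _"] cong: if_cong)
  then show "convex hull (insert 0 (range (\<lambda>i. real_vec (v i)))) \<subseteq> T 1"
    by (intro hull_minimal convex_T) (auto simp: zero_in_T)
  show "T 1 \<subseteq> convex hull (insert 0 (range (\<lambda>i. real_vec (v i))))"
  proof
    fix x assume "x \<in> T 1"
    then obtain l where l: "x = comb l" "\<forall>i. 0 \<le> l i" "sum l UNIV \<le> 1" by (auto simp: T_def)
    let ?C = "convex hull (insert 0 (range (\<lambda>i. real_vec (v i))))"
    \<comment> \<open>\<open>None\<close> indexes the vertex 0 and receives the weight left over by
      the \<open>l i\<close>.\<close>
    let ?l = "\<lambda>j. case j of None \<Rightarrow> 1 - sum l UNIV | Some i \<Rightarrow> l i"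
    let ?y = "\<lambda>j. case j of None \<Rightarrow> 0 | Some i \<Rightarrow> real_vec (v i)"
    have "(\<Sum>j\<in>UNIV. ?l j *\<^sub>R ?y j) \<in> ?C"
    proof (rule convex_sum)
      show "sum ?l UNIV = 1"
        by (simp add: UNIV_option_conv sum.reindex)
      fix j show "?l j \<ge> 0" using l by (auto split: option.split)
      show "?y j \<in> ?C" by (intro hull_inc) (auto split: option.split)
    qed auto
    then show "x \<in> ?C"
      by (simp add: UNIV_option_conv sum.reindex l(1) comb_def)
  qed
qed

lemma T_eq_scale: "t > 0 \<Longrightarrow> T t = (*\<^sub>R) t ` T 1"
proof -
  assume t: "t > 0"
  show ?thesis
  proof
    show "T t \<subseteq> (*\<^sub>R) t ` T 1"
    proof
      fix x assume "x \<in> T t"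
      then have "inverse t *\<^sub>R x \<in> T 1" using T_scale[of t "inverse t *\<^sub>R x" 1] t by simp
      then show "x \<in> (*\<^sub>R) t ` T 1" using t by (intro image_eqI[of _ _ "inverse t *\<^sub>R x"]) auto
    qed
    show "(*\<^sub>R) t ` T 1 \<subseteq> T t" using T_scale[of t _ 1] t by auto
  qed
qed

lemma compact_T: "t > 0 \<Longrightarrow> compact (T t)"
  unfolding T_eq_scale T_1 by (intro compact_scaling finite_imp_compact_convex_hull) auto

lemma bounded_T: "bounded (T t)"
proof -
  \<comment> \<open>Enlarging the parameter makes it positive, as \<open>compact_T\<close>
    requires.\<close>
  have "bounded (T (max t 1))" by (intro compact_imp_bounded compact_T) auto
  then show ?thesis by (rule bounded_subset) (simp add: T_mono)
qed

lemma finite_LT: "finite (LT t)"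
  unfolding LT_def by (rule finite_real_vec_bounded[OF bounded_T])

lemma LT_subset_L: "LT t \<subseteq> L"
  using T_subset_V by (auto simp: LT_def L_def)

lemma V_closed: "0 \<in> V" "x \<in> V \<Longrightarrow> y \<in> V \<Longrightarrow> x + y \<in> V" "x \<in> V \<Longrightarrow> y \<in> V \<Longrightarrow> x - y \<in> V"
  "x \<in> V \<Longrightarrow> c *\<^sub>R x \<in> V"
  by (auto simp: V_def span_zero span_add span_diff span_scale)

lemma G_closed: "0 \<in> G" "x \<in> G \<Longrightarrow> y \<in> G \<Longrightarrow> x + y \<in> G" "x \<in> G \<Longrightarrow> y \<in> G \<Longrightarrow> x - y \<in> G"
proof -
  have "icomb (\<lambda>_. 0) = 0" by (simp add: icomb_def)
  then show "0 \<in> G" unfolding G_def by (metis rangeI)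
qed (auto simp: G_def icomb_add icomb_diff)

lemma L_closed: "0 \<in> L" "x \<in> L \<Longrightarrow> y \<in> L \<Longrightarrow> x + y \<in> L" "x \<in> L \<Longrightarrow> y \<in> L \<Longrightarrow> x - y \<in> L"
  by (auto simp: L_def V_closed real_vec_add real_vec_diff)

lemma G_subset_L: "G \<subseteq> L"
  by (auto simp: G_def L_def real_vec_icomb V_eq_comb)

text \<open>Write each \<open>F j\<close> as a combination of the \<open>v i\<close>, and let
  \<open>M\<close> bound the sum of the absolute values of all coefficients. Adding \<open>M\<close>
  to every coefficient leaves them between 0 and \<open>2 * M\<close> after any perturbation with
  \<open>\<bar>c j\<bar> \<le> 1\<close>.\<close>

lemma perturbed_comb_in_T:
  fixes F :: "'j \<Rightarrow> real ^ 'n"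
  assumes "finite I" "\<And>j. j \<in> I \<Longrightarrow> F j \<in> V"
  shows "\<exists>M::nat. \<forall>c. (\<forall>j\<in>I. \<bar>c j\<bar> \<le> 1) \<longrightarrow>
     comb (\<lambda>_. real M) + (\<Sum>j\<in>I. c j *\<^sub>R F j) \<in> T (real (2 * M * CARD('s)))"
proof -
  have "\<forall>j\<in>I. \<exists>l. F j = comb l" using assms V_eq_comb by auto
  then obtain \<beta> where \<beta>: "\<And>j. j \<in> I \<Longrightarrow> F j = comb (\<beta> j)" by metis
  obtain M :: nat where M: "(\<Sum>j\<in>I. \<Sum>i\<in>UNIV. \<bar>\<beta> j i\<bar>) \<le> real M"
    using real_arch_simple by blast
  show ?thesis
  proof (intro exI[of _ M] allI impI)
    fix c :: "'j \<Rightarrow> real" assume c: "\<forall>j\<in>I. \<bar>c j\<bar> \<le> 1"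
    let ?g = "\<lambda>i. \<Sum>j\<in>I. c j * \<beta> j i"
    have "(\<Sum>j\<in>I. c j *\<^sub>R F j) = (\<Sum>j\<in>I. comb (\<lambda>i. c j * \<beta> j i))"
      using \<beta> by (intro sum.cong) (auto simp flip: comb_scale)
    then have eq: "comb (\<lambda>_. real M) + (\<Sum>j\<in>I. c j *\<^sub>R F j) = comb (\<lambda>i. real M + ?g i)"
      by (simp add: comb_sum comb_add)
    have g: "\<bar>?g i\<bar> \<le> real M" for i
    proof -
      have "\<bar>?g i\<bar> \<le> (\<Sum>j\<in>I. \<bar>c j * \<beta> j i\<bar>)" by (rule sum_abs)
      also have "\<dots> \<le> (\<Sum>j\<in>I. \<bar>\<beta> j i\<bar>)"
        using c by (intro sum_mono) (auto simp: abs_mult mult_left_le_one_le)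
      also have "\<dots> \<le> (\<Sum>j\<in>I. \<Sum>i\<in>UNIV. \<bar>\<beta> j i\<bar>)"
        by (intro sum_mono member_le_sum) auto
      finally show ?thesis using M by linarith
    qed
    have "(\<Sum>i\<in>UNIV. real M + ?g i) \<le> (\<Sum>i\<in>(UNIV::'s set). real (2 * M))"
      using g by (intro sum_mono) (simp add: abs_le_iff)
    then show "comb (\<lambda>_. real M) + (\<Sum>j\<in>I. c j *\<^sub>R F j) \<in> T (real (2 * M * CARD('s)))"
      unfolding eq T_def
    proof (intro image_eqI[OF refl] CollectI conjI allI)
      fix i show "0 \<le> real M + ?g i" using g[of i] by (simp add: abs_le_iff)
    qed (simp add: mult_ac)
  qed
qed

text \<open>A finite set containing every lattice point that is a combination of the
  \<open>v i\<close> with coefficients in \<open>[0, 1]\<close>; such coefficients sum to at most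
  \<open>CARD('s)\<close>.\<close>

definition zono :: "(int ^ 'n) set" where
  "zono = {x. real_vec x \<in> T (CARD('s))}"

lemma finite_zono: "finite zono"
  unfolding zono_def by (rule finite_real_vec_bounded[OF bounded_T])

lemma floor_split:
  assumes "real_vec x = comb l"
  shows "x - icomb (\<lambda>i. \<lfloor>l i\<rfloor>) \<in> zono"
proof -
  have "real_vec (x - icomb (\<lambda>i. \<lfloor>l i\<rfloor>)) = comb (\<lambda>i. frac (l i))"
    by (simp add: real_vec_diff real_vec_icomb assms comb_diff frac_def)
  moreover have "(\<Sum>i\<in>UNIV. frac (l i)) \<le> (\<Sum>i\<in>(UNIV::'s set). 1)"
    by (intro sum_mono) (simp add: frac_lt_1 less_imp_le)
  ultimately show ?thesis
    by (auto simp: zono_def T_def intro!: image_eqI)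
qed

lemma zono_subset_L: "zono \<subseteq> L"
  using T_subset_V by (auto simp: zono_def L_def)

text \<open>The choice depends only on the coset of \<open>x\<close> modulo \<open>G\<close>, by
  \<open>rep_cong\<close>, and is made inside a finite set.\<close>

definition rep :: "int ^ 'n \<Rightarrow> int ^ 'n" where
  "rep x = (SOME y. y \<in> zono \<and> x - y \<in> G)"

lemma rep:
  assumes "x \<in> L"
  shows "rep x \<in> zono" "x - rep x \<in> G"
proof -
  obtain l where "real_vec x = comb l" using assms by (auto simp: L_def V_eq_comb)
  from floor_split[OF this] have "\<exists>y. y \<in> zono \<and> x - y \<in> G"
    by (intro exI[of _ "x - icomb (\<lambda>i. \<lfloor>l i\<rfloor>)"]) (simp add: G_def)
  then have "rep x \<in> zono \<and> x - rep x \<in> G" unfolding rep_def by (rule someI_ex)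
  then show "rep x \<in> zono" "x - rep x \<in> G" by auto
qed

lemma rep_cong:
  assumes "x - y \<in> G"
  shows "rep x = rep y"
proof -
  have "x - z \<in> G \<longleftrightarrow> y - z \<in> G" for z
  proof
    show "y - z \<in> G" if "x - z \<in> G" using G_closed(3)[OF that assms] by simp
    show "x - z \<in> G" if "y - z \<in> G" using G_closed(2)[OF assms that] by simp
  qed
  then show ?thesis by (simp add: rep_def)
qed

text \<open>A system of representatives of \<open>L/G\<close>, so its cardinality is the index of
  \<open>G\<close> in \<open>L\<close>.\<close>

definition Reps :: "(int ^ 'n) set" where
  "Reps = rep ` L"

lemma finite_Reps: "finite Reps"
  by (rule finite_subset[OF _ finite_zono]) (auto simp: Reps_def rep)

lemma Reps_subset_L: "Reps \<subseteq> L"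
  using rep(1) zono_subset_L by (auto simp: Reps_def)

text \<open>\<open>rep\<close> is idempotent on \<open>L\<close>, since \<open>x\<close> and
  \<open>rep x\<close> lie in the same coset.\<close>

lemma Reps_inj: "g \<in> Reps \<Longrightarrow> h \<in> Reps \<Longrightarrow> g - h \<in> G \<Longrightarrow> g = h"
proof -
  have "rep g = g" if "g \<in> Reps" for g
    using that rep(2) unfolding Reps_def by (metis (no_types, lifting) G_closed(1,3) diff_0 imageE minus_diff_eq rep_cong)
  then show "g \<in> Reps \<Longrightarrow> h \<in> Reps \<Longrightarrow> g - h \<in> G \<Longrightarrow> g = h" using rep_cong by metis
qed

lemma Reps_nonempty: "Reps \<noteq> {}"
  using L_closed(1) by (auto simp: Reps_def)

section \<open>Comparison of the Hilbert function with the lattice points of the dilates\<close>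

lemma expo_eq_icomb: "expo v m = icomb (\<lambda>i. int (Poly_Mapping.lookup m i))"
  by (simp add: expo_def icomb_def)

lemma icomb_in_expos:
  assumes "\<And>i. 0 \<le> z i" "sum z UNIV \<le> int t"
  shows "icomb z \<in> expos_upto v t"
proof -
  let ?m = "Abs_poly_mapping (\<lambda>i. nat (z i))"
  have m: "Poly_Mapping.lookup ?m i = nat (z i)" for i by simp
  have "int (tdeg ?m) = sum z UNIV" using assms(1) by (simp add: tdeg_def)
  then have "tdeg ?m \<le> t" using assms(2) by linarith
  moreover have "expo v ?m = icomb z" using assms(1) by (simp add: expo_eq_icomb)
  ultimately show ?thesis unfolding expos_upto_def by (metis (mono_tags, lifting) imageI mem_Collect_eq)
qed

lemma expos_upto_T:
  assumes "u \<in> expos_upto v t"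
  shows "real_vec u \<in> T t" "u \<in> G"
proof -
  obtain m where m: "tdeg m \<le> t" "u = expo v m" using assms by (auto simp: expos_upto_def)
  show "u \<in> G" unfolding m G_def by (simp add: expo_eq_icomb)
  show "real_vec u \<in> T t" unfolding m(2) expo_eq_icomb real_vec_icomb T_def
    by (intro image_eqI[OF refl]) (use m(1) in \<open>auto simp: tdeg_def simp flip: of_nat_sum\<close>)
qed

text \<open>The sums \<open>g + u\<close> are distinct because the \<open>g\<close> lie in different
  cosets of \<open>G\<close> and the \<open>u\<close> lie in \<open>G\<close>. A fixed shift by
  \<open>M\<close> times the sum of the \<open>v i\<close> moves every \<open>g\<close> into a
  dilate of the polytope.\<close>

lemma Reps_expos_le_LT: "\<exists>D::nat. \<forall>t. card Reps * card (expos_upto v t) \<le> card (LT (t + D))"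
proof -
  obtain M :: nat where M: "\<And>c. (\<forall>h\<in>Reps. \<bar>c h\<bar> \<le> 1) \<Longrightarrow>
      comb (\<lambda>_. real M) + (\<Sum>h\<in>Reps. c h *\<^sub>R real_vec h) \<in> T (real (2 * M * CARD('s)))"
    using perturbed_comb_in_T[OF finite_Reps, of real_vec] Reps_subset_L by (auto simp: L_def)
  let ?D = "2 * M * CARD('s)"
  have gT: "comb (\<lambda>_. real M) + real_vec g \<in> T (real ?D)" if "g \<in> Reps" for g
  proof -
    have "(\<Sum>h\<in>Reps. (if h = g then 1 else 0) *\<^sub>R real_vec h) = (\<Sum>h\<in>Reps. if h = g then real_vec h else 0)"
      by (intro sum.cong) auto
    also have "\<dots> = real_vec g" using that finite_Reps by simp
    finally show ?thesis using M[of "\<lambda>h. if h = g then 1 else 0"] by simp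
  qed
  have "card Reps * card (expos_upto v t) \<le> card (LT (t + ?D))" for t
  proof -
    let ?h = "\<lambda>(g, u). icomb (\<lambda>_. int M) + g + u"
    have "card Reps * card (expos_upto v t) = card (Reps \<times> expos_upto v t)"
      by (simp add: card_cartesian_product)
    also have "\<dots> \<le> card (LT (t + ?D))"
    proof (rule card_inj_on_le[where f = ?h])
      show "inj_on ?h (Reps \<times> expos_upto v t)"
      proof (rule inj_onI)
        fix p q assume "p \<in> Reps \<times> expos_upto v t" "q \<in> Reps \<times> expos_upto v t" "?h p = ?h q"
        then obtain g u g' u' where *: "p = (g, u)" "q = (g', u')"
          "g \<in> Reps" "u \<in> expos_upto v t" "g' \<in> Reps" "u' \<in> expos_upto v t" "g + u = g' + u'"
          by (cases p; cases q) (auto simp: add.assoc)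
        then have "g - g' = u' - u" by (simp add: algebra_simps)
        then have "g - g' \<in> G" using expos_upto_T(2) * G_closed(3) by metis
        then have "g = g'" using Reps_inj * by blast
        then show "p = q" using * by simp
      qed
      show "?h ` (Reps \<times> expos_upto v t) \<subseteq> LT (t + ?D)"
      proof (rule image_subsetI)
        fix p assume "p \<in> Reps \<times> expos_upto v t"
        then obtain g u where *: "g \<in> Reps" "u \<in> expos_upto v t" "p = (g, u)" by auto
        have "real_vec (icomb (\<lambda>_. int M) + g + u) = real_vec u + (comb (\<lambda>_. real M) + real_vec g)"
          by (simp add: real_vec_add real_vec_icomb)
        also have "\<dots> \<in> T (real t + real ?D)" by (intro T_add expos_upto_T(1) gT *)
        finally show "?h p \<in> LT (t + ?D)"
          using * by (simp add: LT_def)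
      qed
    qed (rule finite_LT)
    finally show ?thesis by simp
  qed
  then show ?thesis by blast
qed

text \<open>A point \<open>x\<close> is determined by \<open>rep x\<close> and
  \<open>x - rep x\<close>. The latter is the rounded-down combination plus an element of the finite
  set \<open>F\<close>, whose possibly negative integer coefficients are repaired by a fixed
  shift.\<close>

lemma LT_le_Reps_expos: "\<exists>D::nat. \<forall>t::nat. card (LT t) \<le> card Reps * card (expos_upto v (t + D))"
proof -
  \<comment> \<open>All possible differences in \<open>G\<close> between a remainder after rounding
    down and a representative.\<close>
  define F where "F = (\<lambda>(x, g). x - g) ` (zono \<times> Reps) \<inter> G"
  have "finite F" unfolding F_def using finite_zono finite_Reps by auto
  have "\<forall>f\<in>F. \<exists>z. f = icomb z" by (auto simp: F_def G_def)
  then obtain \<zeta> where \<zeta>: "\<And>f. f \<in> F \<Longrightarrow> f = icomb (\<zeta> f)" by metis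
  define M where "M = nat (\<Sum>f\<in>F. \<Sum>i\<in>UNIV. \<bar>\<zeta> f i\<bar>)"
  have M: "\<bar>\<zeta> f i\<bar> \<le> int M" if "f \<in> F" for f i
  proof -
    have "\<bar>\<zeta> f i\<bar> \<le> (\<Sum>i\<in>UNIV. \<bar>\<zeta> f i\<bar>)" by (intro member_le_sum) auto
    also have "\<dots> \<le> (\<Sum>f\<in>F. \<Sum>i\<in>UNIV. \<bar>\<zeta> f i\<bar>)"
      using that \<open>finite F\<close> by (intro member_le_sum) (auto intro: sum_nonneg)
    finally show ?thesis by (simp add: M_def sum_nonneg)
  qed
  let ?D = "2 * M * CARD('s)"
  have "card (LT t) \<le> card Reps * card (expos_upto v (t + ?D))" for t :: nat
  proof -
    let ?h = "\<lambda>x. (rep x, x - rep x + icomb (\<lambda>_. int M))"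
    have "card (LT t) \<le> card (Reps \<times> expos_upto v (t + ?D))"
    proof (rule card_inj_on_le[where f = ?h])
      show "inj_on ?h (LT t)" by (rule inj_onI) auto
      show "?h ` LT t \<subseteq> Reps \<times> expos_upto v (t + ?D)"
      proof (intro image_subsetI SigmaI)
        fix x assume x: "x \<in> LT t"
        then have xL: "x \<in> L" using LT_subset_L by blast
        then show "rep x \<in> Reps" by (simp add: Reps_def)
        obtain l where l: "real_vec x = comb l" "\<forall>i. 0 \<le> l i" "sum l UNIV \<le> t"
          using x by (auto simp: LT_def T_def)
        let ?r = "x - icomb (\<lambda>i. \<lfloor>l i\<rfloor>)"
        have "?r - rep x = (x - rep x) - icomb (\<lambda>i. \<lfloor>l i\<rfloor>)" by simp
        also have "\<dots> \<in> G" by (intro G_closed rep xL) (simp add: G_def)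
        finally have rF: "?r - rep x \<in> F"
          unfolding F_def using floor_split[OF l(1)] xL by (auto simp: Reps_def image_iff)
        \<comment> \<open>The shifted coefficients are nonnegative, and each exceeds the floor by at
          most \<open>2 * M\<close>; this accounts for \<open>?D\<close>.\<close>
        have "x - rep x + icomb (\<lambda>_. int M) = icomb (\<lambda>i. \<lfloor>l i\<rfloor>) + (?r - rep x) + icomb (\<lambda>_. int M)"
          by simp
        also have "\<dots> = icomb (\<lambda>i. \<lfloor>l i\<rfloor> + \<zeta> (?r - rep x) i + int M)"
          by (subst \<zeta>[OF rF]) (simp add: icomb_add)
        also have "\<dots> \<in> expos_upto v (t + ?D)"
        proof (rule icomb_in_expos)
          fix i show "0 \<le> \<lfloor>l i\<rfloor> + \<zeta> (?r - rep x) i + int M"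
            using l(2)[rule_format, of i] M[OF rF, of i] zero_le_floor[of "l i"] by linarith
        next
          have "(\<Sum>i\<in>UNIV. \<lfloor>l i\<rfloor> + \<zeta> (?r - rep x) i + int M) \<le> (\<Sum>i\<in>UNIV. \<lfloor>l i\<rfloor> + 2 * int M)"
            using M[OF rF] by (intro sum_mono) (simp add: abs_le_iff)
          also have "\<dots> = (\<Sum>i\<in>UNIV. \<lfloor>l i\<rfloor>) + int ?D" by (simp add: sum.distrib)
          also have "(\<Sum>i\<in>UNIV. \<lfloor>l i\<rfloor>) \<le> int t"
          proof -
            have "real_of_int (\<Sum>i\<in>UNIV. \<lfloor>l i\<rfloor>) \<le> sum l UNIV"
              unfolding of_int_sum by (intro sum_mono) simp
            then show ?thesis using l(3) by linarith
          qed
          finally show "(\<Sum>i\<in>UNIV. \<lfloor>l i\<rfloor> + \<zeta> (?r - rep x) i + int M) \<le> int (t + ?D)" by simp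
        qed
        finally show "x - rep x + icomb (\<lambda>_. int M) \<in> expos_upto v (t + ?D)" .
      qed
      show "finite (Reps \<times> expos_upto v (t + ?D))" using finite_Reps finite_expos_upto by blast
    qed
    then show ?thesis by (simp add: card_cartesian_product)
  qed
  then show ?thesis by blast
qed

end

section \<open>Volume\<close>

text \<open>The preimage is \<open>A\<close> scaled by \<open>t\<close> and translated by
  \<open>q\<close>.\<close>

lemma emeasure_lborel_affine_vimage:
  fixes q t :: real
  assumes "t > 0" "A \<in> sets borel"
  shows "emeasure lborel ((\<lambda>x. (x - q) / t) -` A) = ennreal t * emeasure lborel A"
proof -
  have "emeasure lborel A = emeasure (density (distr lborel borel (\<lambda>x. - q / t + (1 / t) * x)) (\<lambda>_. ennreal \<bar>1 / t\<bar>)) A"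
    using lborel_real_affine[of "1 / t" "- q / t"] assms by simp
  also have "\<dots> = ennreal (1 / t) * emeasure lborel ((\<lambda>x. - q / t + (1 / t) * x) -` A)"
    using assms by (simp add: emeasure_density emeasure_distr nn_integral_cmult_indicator)
  also have "(\<lambda>x. - q / t + (1 / t) * x) = (\<lambda>x. (x - q) / t)"
    by (auto simp: diff_divide_distrib)
  finally have "ennreal t * emeasure lborel A = ennreal t * (ennreal (1 / t) * emeasure lborel ((\<lambda>x. (x - q) / t) -` A))"
    by simp
  also have "\<dots> = emeasure lborel ((\<lambda>x. (x - q) / t) -` A)"
    using assms by (simp flip: mult.assoc ennreal_mult')
  finally show ?thesis by simp
qed

text \<open>Uniqueness of the product measure reduces the claim to boxes, where the one-dimensional
  case applies to each factor.\<close>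

lemma emeasure_PiM_lborel_affine_vimage:
  fixes t :: real and q :: "'i \<Rightarrow> real"
  assumes I: "finite I" and t: "t > 0" and S: "S \<in> sets (\<Pi>\<^sub>M i\<in>I. lborel)"
  shows "emeasure (\<Pi>\<^sub>M i\<in>I. lborel) {c \<in> I \<rightarrow>\<^sub>E UNIV. (\<lambda>i\<in>I. (c i - q i) / t) \<in> S}
     = ennreal (t ^ card I) * emeasure (\<Pi>\<^sub>M i\<in>I. lborel) S"
proof -
  interpret product_sigma_finite "\<lambda>_::'i. lborel :: real measure" ..
  let ?M = "\<Pi>\<^sub>M i\<in>I. (lborel :: real measure)"
  let ?f = "\<lambda>c. \<lambda>i\<in>I. (c i - q i) / t"
  have sp: "space ?M = I \<rightarrow>\<^sub>E UNIV" by (simp add: space_PiM)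
  have meas: "?f \<in> measurable ?M ?M"
    by (intro measurable_restrict) (auto intro!: borel_measurable_divide borel_measurable_diff)
  \<comment> \<open>The image measure, normalized so that it agrees with the product measure on
    boxes.\<close>
  define P where "P = scale_measure (ennreal (1 / t ^ card I)) (distr ?M ?M ?f)"
  have "P = ?M"
  proof (rule PiM_eqI[OF I])
    show "sets P = sets ?M" by (simp add: P_def)
    fix A :: "'i \<Rightarrow> real set" assume A: "\<And>i. i \<in> I \<Longrightarrow> A i \<in> sets lborel"
    have "?f -` (Pi\<^sub>E I A) \<inter> space ?M = Pi\<^sub>E I (\<lambda>i. (\<lambda>x. (x - q i) / t) -` A i)"
      by (auto simp: sp PiE_iff)
    then have "emeasure P (Pi\<^sub>E I A) = ennreal (1 / t ^ card I) * emeasure ?M (Pi\<^sub>E I (\<lambda>i. (\<lambda>x. (x - q i) / t) -` A i))"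
      using A I by (simp add: P_def emeasure_distr[OF meas] sets_PiM_I_finite)
    also have "emeasure ?M (Pi\<^sub>E I (\<lambda>i. (\<lambda>x. (x - q i) / t) -` A i))
        = (\<Prod>i\<in>I. emeasure lborel ((\<lambda>x. (x - q i) / t) -` A i))"
    proof (rule emeasure_PiM[OF I])
      fix i assume "i \<in> I"
      have "(\<lambda>x. (x - q i) / t) \<in> borel_measurable borel" by measurable
      from measurable_sets[OF this, of "A i"] show "(\<lambda>x. (x - q i) / t) -` A i \<in> sets lborel"
        using A[OF \<open>i \<in> I\<close>] by simp
    qed
    also have "\<dots> = (\<Prod>i\<in>I. ennreal t * emeasure lborel (A i))"
      using A t by (intro prod.cong refl emeasure_lborel_affine_vimage) auto
    also have "\<dots> = ennreal (t ^ card I) * (\<Prod>i\<in>I. emeasure lborel (A i))"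
      using t by (simp add: prod.distrib ennreal_power)
    also have "ennreal (1 / t ^ card I) * (ennreal (t ^ card I) * (\<Prod>i\<in>I. emeasure lborel (A i)))
        = (\<Prod>i\<in>I. emeasure lborel (A i))"
      using t by (simp flip: mult.assoc ennreal_mult')
    finally show "emeasure P (Pi\<^sub>E I A) = (\<Prod>i\<in>I. emeasure lborel (A i))" .
  qed
  then have "emeasure ?M S = emeasure P S" by simp
  also have "\<dots> = ennreal (1 / t ^ card I) * emeasure ?M (?f -` S \<inter> space ?M)"
    by (simp add: P_def emeasure_distr[OF meas S])
  finally have "ennreal (t ^ card I) * emeasure ?M S
     = ennreal (t ^ card I) * (ennreal (1 / t ^ card I) * emeasure ?M (?f -` S \<inter> space ?M))"
    by simp
  also have "\<dots> = emeasure ?M (?f -` S \<inter> space ?M)"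
    using t by (simp flip: mult.assoc ennreal_mult')
  also have "?f -` S \<inter> space ?M = {c \<in> I \<rightarrow>\<^sub>E UNIV. ?f c \<in> S}"
    by (auto simp: sp)
  finally show ?thesis by simp
qed

section \<open>Lattice coordinates and the volume of the dilates\<close>

context lattice_vectors
begin

text \<open>For \<open>x\<close> in \<open>L\<close> only the entries with index below
  \<open>d\<close> are determined.\<close>

definition coord :: "int ^ 'n \<Rightarrow> nat \<Rightarrow> int" where
  "coord x = (SOME c. x = (\<Sum>i<d. c i *s b i))"

lemma coord: "x \<in> L \<Longrightarrow> x = (\<Sum>i<d. coord x i *s b i)"
proof -
  assume "x \<in> L"
  then have "\<exists>c. x = (\<Sum>i<d. c i *s b i)" using basis_gen by (simp add: L_def V_def)
  from someI_ex[OF this] show ?thesis by (simp only: coord_def)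
qed

lemma basis_unique:
  assumes "(\<Sum>i<d. c i *\<^sub>R real_vec (b i)) = (\<Sum>i<d. c' i *\<^sub>R real_vec (b i))" "i < d"
  shows "c i = c' i"
  using basis_indep[of "\<lambda>i. c i - c' i" i] assms
  by (simp add: scaleR_diff_left sum_subtractf)

lemma coord_unique:
  assumes "x = (\<Sum>i<d. c i *s b i)" "i < d"
  shows "coord x i = c i"
proof -
  have "x \<in> L" unfolding L_def assms(1)
    using basis_in by (auto simp: real_vec_sum real_vec_smult V_def intro!: span_sum span_scale)
  then have "(\<Sum>i<d. coord x i *s b i) = (\<Sum>i<d. c i *s b i)" using coord assms(1) by simp
  then have "real_vec (\<Sum>i<d. coord x i *s b i) = real_vec (\<Sum>i<d. c i *s b i)" by simp
  then show ?thesis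
    using basis_unique[of "\<lambda>i. real_of_int (coord x i)" "\<lambda>i. real_of_int (c i)" i] assms(2)
    by (simp add: real_vec_sum real_vec_smult)
qed

lemma b_in_L: "i < d \<Longrightarrow> b i \<in> L"
  using basis_in by (simp add: L_def V_def)

lemma coord_add: "x \<in> L \<Longrightarrow> y \<in> L \<Longrightarrow> i < d \<Longrightarrow> coord (x + y) i = coord x i + coord y i"
  using coord[of x] coord[of y] by (intro coord_unique) (simp_all add: vector_sadd_rdistrib sum.distrib)

definition \<phi> :: "(nat \<Rightarrow> real) \<Rightarrow> real ^ 'n" where
  "\<phi> c = (\<Sum>i<d. c i *\<^sub>R real_vec (b i))"

abbreviation leb :: "(nat \<Rightarrow> real) measure" where
  "leb \<equiv> \<Pi>\<^sub>M i\<in>{..<d}. lborel"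

text \<open>The dilate \<open>T t\<close> in lattice coordinates, where relative volume becomes
  Lebesgue measure.\<close>

definition body :: "real \<Rightarrow> (nat \<Rightarrow> real) set" where
  "body t = {c \<in> {..<d} \<rightarrow>\<^sub>E UNIV. \<phi> c \<in> T t}"

lemma phi_cong: "(\<And>i. i < d \<Longrightarrow> c i = c' i) \<Longrightarrow> \<phi> c = \<phi> c'"
  by (auto simp: \<phi>_def)

lemma phi_add: "\<phi> (\<lambda>i. c i + c' i) = \<phi> c + \<phi> c'"
  by (simp add: \<phi>_def scaleR_add_left sum.distrib)

lemma phi_scale: "\<phi> (\<lambda>i. k * c i) = k *\<^sub>R \<phi> c"
  by (simp add: \<phi>_def scaleR_sum_right)

lemma real_vec_coord: "x \<in> L \<Longrightarrow> real_vec x = \<phi> (\<lambda>i. real_of_int (coord x i))"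
  by (subst coord) (auto simp: \<phi>_def real_vec_sum real_vec_smult)

lemma phi_measurable [measurable]: "\<phi> \<in> borel_measurable leb"
  unfolding \<phi>_def by measurable

lemma body_sets: "t > 0 \<Longrightarrow> body t \<in> sets leb"
proof -
  assume "t > 0"
  then have "T t \<in> sets borel" by (intro borel_compact compact_T)
  from measurable_sets[OF phi_measurable this] show ?thesis
    by (simp add: body_def space_PiM vimage_def Int_def conj_commute)
qed

lemma emeasure_body_scale:
  assumes "t > 0"
  shows "emeasure leb (body t) = ennreal (t ^ d) * emeasure leb (body 1)"
proof -
  have "(\<lambda>i\<in>{..<d}. (c i - 0) / t) \<in> body 1 \<longleftrightarrow> \<phi> c \<in> T t" for c
  proof -
    have "\<phi> (\<lambda>i\<in>{..<d}. (c i - 0) / t) = (1 / t) *\<^sub>R \<phi> c"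
      unfolding phi_scale[symmetric] by (intro phi_cong) auto
    then show ?thesis using T_scale[of t "(1 / t) *\<^sub>R \<phi> c" 1] assms by (simp add: body_def)
  qed
  then show ?thesis
    using emeasure_PiM_lborel_affine_vimage[of "{..<d}" t "body 1" "\<lambda>_. 0"] assms body_sets[of 1]
    by (simp add: body_def)
qed

text \<open>Translation invariance of Lebesgue measure. It serves frames whose origin differs from
  0.\<close>

lemma emeasure_body_translate:
  "emeasure leb {c \<in> {..<d} \<rightarrow>\<^sub>E UNIV. \<phi> q + \<phi> c \<in> T 1} = emeasure leb (body 1)"
proof -
  have "(\<lambda>i\<in>{..<d}. (c i - - q i) / 1) \<in> body 1 \<longleftrightarrow> \<phi> q + \<phi> c \<in> T 1" for c
  proof -
    have "\<phi> (\<lambda>i\<in>{..<d}. (c i - - q i) / 1) = \<phi> q + \<phi> c"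
      unfolding phi_add[symmetric] by (intro phi_cong) auto
    then show ?thesis by (simp add: body_def)
  qed
  then show ?thesis
    using emeasure_PiM_lborel_affine_vimage[of "{..<d}" 1 "body 1" "\<lambda>i. - q i"] body_sets[of 1]
    by simp
qed

text \<open>Half-open, so that the cubes at distinct lattice points are disjoint and together cover
  the coordinate space.\<close>

definition cube :: "int ^ 'n \<Rightarrow> (nat \<Rightarrow> real) set" where
  "cube x = (\<Pi>\<^sub>E i\<in>{..<d}. {real_of_int (coord x i)..<real_of_int (coord x i) + 1})"

lemma cube_sets: "cube x \<in> sets leb"
  unfolding cube_def by (intro sets_PiM_I_finite) auto

lemma emeasure_cube: "emeasure leb (cube x) = 1"
proof -
  interpret product_sigma_finite "\<lambda>_::nat. lborel :: real measure" ..
  show ?thesis unfolding cube_def by (subst emeasure_PiM) auto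
qed

lemma mem_cube_iff: "c \<in> cube x \<longleftrightarrow> c \<in> {..<d} \<rightarrow>\<^sub>E UNIV \<and> (\<forall>i<d. \<lfloor>c i\<rfloor> = coord x i)"
  by (auto simp: cube_def PiE_iff floor_eq_iff)

lemma cube_disjoint:
  assumes "x \<in> L" "y \<in> L" "c \<in> cube x" "c \<in> cube y"
  shows "x = y"
proof -
  have "coord x i = coord y i" if "i < d" for i using assms that by (auto simp: mem_cube_iff)
  then have "(\<Sum>i<d. coord x i *s b i) = (\<Sum>i<d. coord y i *s b i)" by simp
  then show ?thesis using coord assms by metis
qed

lemma emeasure_cubes:
  assumes "finite A" "A \<subseteq> L"
  shows "emeasure leb (\<Union>x\<in>A. cube x) = of_nat (card A)"
proof -
  have "disjoint_family_on cube A"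
    unfolding disjoint_family_on_def using assms(2) cube_disjoint by blast
  then have "emeasure leb (\<Union>x\<in>A. cube x) = (\<Sum>x\<in>A. emeasure leb (cube x))"
    using assms(1) by (intro sum_emeasure[symmetric]) (auto simp: cube_sets)
  then show ?thesis by (simp add: emeasure_cube)
qed

text \<open>Points on the boundary of the cone spanned by the \<open>v i\<close> leave it under
  small perturbations; a fixed lattice shift into the cone prevents this, at the cost of a constant
  in the dilation factor.\<close>

lemma perturbed_in_T:
  "\<exists>M::nat. \<forall>s c. (\<forall>i<d. \<bar>c i\<bar> \<le> 1) \<longrightarrow> (\<forall>x\<in>T s. x + real_vec (icomb (\<lambda>_. int M)) + \<phi> c \<in> T (s + real (2 * M * CARD('s))))"
proof -
  obtain M :: nat where M: "\<And>c. (\<forall>i\<in>{..<d}. \<bar>c i\<bar> \<le> 1) \<Longrightarrow>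
      comb (\<lambda>_. real M) + (\<Sum>i<d. c i *\<^sub>R real_vec (b i)) \<in> T (real (2 * M * CARD('s)))"
    using perturbed_comb_in_T[of "{..<d}" "\<lambda>i. real_vec (b i)"] b_in_L by (auto simp: L_def)
  have "x + real_vec (icomb (\<lambda>_. int M)) + \<phi> c \<in> T (s + real (2 * M * CARD('s)))"
    if "\<forall>i<d. \<bar>c i\<bar> \<le> 1" "x \<in> T s" for c x s
    using T_add[OF that(2) M[of c]] that(1) by (simp add: \<phi>_def real_vec_icomb add.assoc)
  then show ?thesis by blast
qed

text \<open>The cubes at the shifted lattice points are disjoint, have volume 1 and fit into a
  slightly larger dilate.\<close>

lemma LT_le_volume:
  "\<exists>D::nat. \<forall>t::nat. of_nat (card (LT t)) \<le> ennreal (real (t + D) ^ d) * emeasure leb (body 1)"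
proof -
  obtain M :: nat where M: "\<And>s c x. (\<forall>i<d. \<bar>c i\<bar> \<le> 1) \<Longrightarrow> x \<in> T s \<Longrightarrow>
      x + real_vec (icomb (\<lambda>_. int M)) + \<phi> c \<in> T (s + real (2 * M * CARD('s)))"
    using perturbed_in_T by blast
  \<comment> \<open>\<open>Suc\<close> keeps the dilation factor positive at
    \<open>t = 0\<close>.\<close>
  let ?D = "Suc (2 * M * CARD('s))" and ?p = "icomb (\<lambda>_. int M)"
  have "?p \<in> L" using G_subset_L by (auto simp: G_def)
  have "of_nat (card (LT t)) \<le> ennreal (real (t + ?D) ^ d) * emeasure leb (body 1)" for t :: nat
  proof -
    have fin: "finite ((+) ?p ` LT t)" by (simp add: finite_LT)
    have sub: "(+) ?p ` LT t \<subseteq> L" using LT_subset_L L_closed(2) \<open>?p \<in> L\<close> by blast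
    have "of_nat (card (LT t)) = emeasure leb (\<Union>x\<in>(+) ?p ` LT t. cube x)"
      using emeasure_cubes[OF fin sub] by (simp add: card_image)
    also have "\<dots> \<le> emeasure leb (body (t + ?D))"
    proof (rule emeasure_mono)
      show "body (t + ?D) \<in> sets leb" by (intro body_sets add_nonneg_pos) (simp_all del: of_nat_Suc)
      show "(\<Union>x\<in>(+) ?p ` LT t. cube x) \<subseteq> body (t + ?D)"
      proof (intro UN_least subsetI)
        fix y c assume "y \<in> (+) ?p ` LT t" and c: "c \<in> cube y"
        then obtain x where x: "x \<in> LT t" "y = ?p + x" by auto
        have y: "y \<in> L" using x sub by blast
        \<comment> \<open>A point of the cube is its corner plus its fractional parts, a
          perturbation with coordinates in \<open>[0, 1)\<close>.\<close>
        let ?f = "\<lambda>i. frac (c i)"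
        have "\<phi> c = \<phi> (\<lambda>i. real_of_int (coord y i) + ?f i)"
          using c by (intro phi_cong) (auto simp: mem_cube_iff frac_def)
        also have "\<dots> = real_vec y + \<phi> ?f"
          by (simp only: phi_add real_vec_coord[OF y])
        also have "\<dots> = real_vec x + real_vec ?p + \<phi> ?f"
          by (simp add: x(2) real_vec_add)
        also have "\<dots> \<in> T (t + real (2 * M * CARD('s)))"
          by (intro M) (use x in \<open>auto simp: LT_def frac_lt_1 less_imp_le\<close>)
        also have "\<dots> \<subseteq> T (t + ?D)" by (intro T_mono) auto
        finally show "c \<in> body (t + ?D)" using c by (simp add: body_def mem_cube_iff)
      qed
    qed
    also have "\<dots> = ennreal (real (t + ?D) ^ d) * emeasure leb (body 1)"
      unfolding of_nat_add by (intro emeasure_body_scale add_nonneg_pos) (simp_all del: of_nat_Suc)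
    finally show ?thesis .
  qed
  then show ?thesis by blast
qed

text \<open>Conversely, the dilate is covered by unit cubes whose corners, after the fixed shift,
  are lattice points of a slightly larger dilate.\<close>

lemma volume_le_LT:
  "\<exists>D::nat. \<forall>t::nat. t > 0 \<longrightarrow> ennreal (real t ^ d) * emeasure leb (body 1) \<le> of_nat (card (LT (t + D)))"
proof -
  obtain M :: nat where M: "\<And>s c x. (\<forall>i<d. \<bar>c i\<bar> \<le> 1) \<Longrightarrow> x \<in> T s \<Longrightarrow>
      x + real_vec (icomb (\<lambda>_. int M)) + \<phi> c \<in> T (s + real (2 * M * CARD('s)))"
    using perturbed_in_T by blast
  let ?D = "2 * M * CARD('s)" and ?p = "icomb (\<lambda>_. int M)"
  have pL: "?p \<in> L" using G_subset_L by (auto simp: G_def)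
  have "ennreal (real t ^ d) * emeasure leb (body 1) \<le> of_nat (card (LT (t + ?D)))" if t: "t > 0" for t :: nat
  proof -
    let ?A = "(\<lambda>x. x - ?p) ` LT (t + ?D)"
    have fin: "finite ?A" by (simp add: finite_LT)
    have sub: "?A \<subseteq> L" using LT_subset_L L_closed(3) pL by blast
    have "ennreal (real t ^ d) * emeasure leb (body 1) = emeasure leb (body t)"
      using emeasure_body_scale[of "real t"] t by simp
    also have "\<dots> \<le> emeasure leb (\<Union>x\<in>?A. cube x)"
    proof (rule emeasure_mono)
      show "(\<Union>x\<in>?A. cube x) \<in> sets leb" using fin by (intro sets.finite_UN cube_sets)
      show "body t \<subseteq> (\<Union>x\<in>?A. cube x)"
      proof
        fix c assume c: "c \<in> body t"
        \<comment> \<open>The corner of the cube containing \<open>c\<close>; it differs from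
          \<open>c\<close> by a perturbation with coordinates in \<open>(-1, 0]\<close>.\<close>
        define y where "y = (\<Sum>i<d. \<lfloor>c i\<rfloor> *s b i)"
        have "y \<in> L" unfolding y_def L_def using basis_in
          by (auto simp: real_vec_sum real_vec_smult V_def intro!: span_sum span_scale)
        have cf_y: "coord y i = \<lfloor>c i\<rfloor>" if "i < d" for i
          by (rule coord_unique[OF y_def that])
        have "real_vec y = \<phi> (\<lambda>i. c i + - frac (c i))"
          unfolding real_vec_coord[OF \<open>y \<in> L\<close>] by (intro phi_cong) (simp add: cf_y frac_def)
        then have "real_vec (y + ?p) = \<phi> c + real_vec ?p + \<phi> (\<lambda>i. - frac (c i))"
          by (simp only: phi_add real_vec_add) simp
        also have "\<dots> \<in> T (t + real ?D)"
          by (intro M) (use c in \<open>auto simp: body_def frac_lt_1 less_imp_le\<close>)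
        finally have "y + ?p \<in> LT (t + ?D)" by (simp add: LT_def)
        then have "y \<in> ?A" by (intro image_eqI[of _ _ "y + ?p"]) auto
        moreover have "c \<in> cube y" using c cf_y by (simp add: mem_cube_iff body_def)
        ultimately show "c \<in> (\<Union>x\<in>?A. cube x)" by blast
      qed
    qed
    also have "\<dots> = of_nat (card (LT (t + ?D)))"
      using emeasure_cubes[OF fin sub] by (simp add: card_image inj_on_def)
    finally show ?thesis .
  qed
  then show ?thesis by blast
qed

section \<open>Asymptotics of the Hilbert function\<close>

definition W :: real where
  "W = measure leb (body 1)"

lemma W_nonneg: "0 \<le> W"
  by (simp add: W_def)

text \<open>The volume is finite because \<open>volume_le_LT\<close> at \<open>t = 1\<close> bounds
  it by a finite number of lattice points.\<close>

lemma emeasure_body_1: "emeasure leb (body 1) = ennreal W"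
proof -
  obtain D :: nat where "\<And>t::nat. t > 0 \<Longrightarrow> ennreal (real t ^ d) * emeasure leb (body 1) \<le> of_nat (card (LT (t + D)))"
    using volume_le_LT by blast
  from this[of 1] have "emeasure leb (body 1) \<le> of_nat (card (LT (1 + D)))" by simp
  also have "\<dots> < \<infinity>" by (simp add: of_nat_less_top)
  finally show ?thesis unfolding W_def by (simp add: emeasure_eq_ennreal_measure)
qed

text \<open>The four comparisons are chained; by monotonicity the sum of their constants serves for
  both directions.\<close>

lemma expos_bounds:
  "\<exists>D::nat. (\<forall>t::nat. real (card Reps) * real (card (expos_upto v t)) \<le> real (t + D) ^ d * W) \<and>
     (\<forall>t::nat. t > 0 \<longrightarrow> real t ^ d * W \<le> real (card Reps) * real (card (expos_upto v (t + D))))"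
proof -
  have conv: "ennreal (real t ^ d) * emeasure leb (body 1) = ennreal (real t ^ d * W)" for t
    by (simp add: emeasure_body_1 ennreal_mult')
  obtain D1 :: nat where D1: "\<And>t. card Reps * card (expos_upto v t) \<le> card (LT (real (t + D1)))"
    using Reps_expos_le_LT by auto
  obtain D2 :: nat where D2: "\<And>t::nat. of_nat (card (LT t)) \<le> ennreal (real (t + D2) ^ d) * emeasure leb (body 1)"
    using LT_le_volume by blast
  obtain D3 :: nat where D3: "\<And>t::nat. t > 0 \<Longrightarrow> ennreal (real t ^ d) * emeasure leb (body 1) \<le> of_nat (card (LT (t + D3)))"
    using volume_le_LT by blast
  obtain D4 :: nat where D4: "\<And>t::nat. card (LT t) \<le> card Reps * card (expos_upto v (t + D4))"
    using LT_le_Reps_expos by blast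
  have mono: "card (expos_upto v t) \<le> card (expos_upto v t')" if "t \<le> t'" for t t'
    using that by (intro card_mono finite_expos_upto) (auto simp: expos_upto_def)
  have D2': "real (card (LT (real t))) \<le> real (t + D2) ^ d * W" for t :: nat
    using D2[of t] unfolding conv by (simp add: W_nonneg ennreal_of_nat_eq_real_of_nat)
  have D3': "real t ^ d * W \<le> real (card (LT (real (t + D3))))" if "t > 0" for t :: nat
    using D3[OF that] unfolding conv by (simp add: ennreal_of_nat_eq_real_of_nat)
  show ?thesis
  proof (intro exI[of _ "D1 + D2 + D3 + D4"] conjI allI impI)
    fix t :: nat
    have "real (card Reps) * real (card (expos_upto v t)) \<le> real (card (LT (real (t + D1))))"
      using D1[of t] by (simp flip: of_nat_mult)
    also have "\<dots> \<le> real (t + D1 + D2) ^ d * W" by (rule D2')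
    also have "\<dots> \<le> real (t + (D1 + D2 + D3 + D4)) ^ d * W"
      by (intro mult_right_mono power_mono) (auto simp: W_nonneg)
    finally show "real (card Reps) * real (card (expos_upto v t)) \<le> real (t + (D1 + D2 + D3 + D4)) ^ d * W" .
  next
    fix t :: nat assume "t > 0"
    then have "real t ^ d * W \<le> real (card (LT (real (t + D3))))" by (rule D3')
    also have "\<dots> \<le> real (card Reps * card (expos_upto v (t + D3 + D4)))"
      using D4[of "t + D3"] by (simp only: of_nat_le_iff)
    also have "\<dots> \<le> real (card Reps) * real (card (expos_upto v (t + (D1 + D2 + D3 + D4))))"
      using mono[of "t + D3 + D4" "t + (D1 + D2 + D3 + D4)"] by (simp add: mult_left_mono)
    finally show "real t ^ d * W \<le> real (card Reps) * real (card (expos_upto v (t + (D1 + D2 + D3 + D4))))" .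
  qed
qed

text \<open>A constant change of the dilation factor disappears in the limit, as
  \<open>(1 + a / t)^d\<close> tends to 1.\<close>

lemma expos_limit:
  "(\<lambda>t. real (card Reps) * real (card (expos_upto v t)) / real t ^ d) \<longlonglongrightarrow> W"
proof -
  obtain D :: nat where
    up: "\<And>t. real (card Reps) * real (card (expos_upto v t)) \<le> real (t + D) ^ d * W" and
    lo: "\<And>t. t > 0 \<Longrightarrow> real t ^ d * W \<le> real (card Reps) * real (card (expos_upto v (t + D)))"
    using expos_bounds by blast
  have lim: "(\<lambda>t. (1 + a / real t) ^ d * W) \<longlonglongrightarrow> W" for a
  proof -
    have "(\<lambda>t. (1 + a / real t) ^ d * W) \<longlonglongrightarrow> (1 + 0) ^ d * W"
      by (intro tendsto_intros lim_const_over_n)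
    then show ?thesis by simp
  qed
  show ?thesis
  proof (rule tendsto_sandwich[OF _ _ lim[of "- real D"] lim[of "real D"]])
    show "\<forall>\<^sub>F t in sequentially. (1 + - real D / real t) ^ d * W
        \<le> real (card Reps) * real (card (expos_upto v t)) / real t ^ d"
      using eventually_gt_at_top[of D]
    proof eventually_elim
      case (elim t)
      then have "1 + - real D / real t = real (t - D) / real t" by (simp add: field_simps of_nat_diff)
      then have "(1 + - real D / real t) ^ d * W = real (t - D) ^ d * W / real t ^ d"
        by (simp add: power_divide)
      \<comment> \<open>The lower bound is used at \<open>t - D\<close>, which is positive
        here.\<close>
      also have "\<dots> \<le> real (card Reps) * real (card (expos_upto v t)) / real t ^ d"
        using lo[of "t - D"] elim by (intro divide_right_mono) auto
      finally show ?case .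
    qed
    show "\<forall>\<^sub>F t in sequentially. real (card Reps) * real (card (expos_upto v t)) / real t ^ d
        \<le> (1 + real D / real t) ^ d * W"
      using eventually_gt_at_top[of 0]
    proof eventually_elim
      case (elim t)
      then have "1 + real D / real t = real (t + D) / real t" by (simp add: field_simps)
      then have "(1 + real D / real t) ^ d * W = real (t + D) ^ d * W / real t ^ d"
        by (simp add: power_divide)
      then show ?case using up[of t] by (simp add: divide_right_mono)
    qed
  qed
qed

text \<open>For \<open>t \<ge> 1\<close> one has \<open>t + D \<le> (1 + D) * t\<close>, and
  \<open>card Reps\<close> is at least 1.\<close>

lemma expos_growth:
  "\<exists>C. \<forall>t\<ge>1. real (card (expos_upto v t)) \<le> C * real t ^ d"
proof -
  obtain D :: nat where
    up: "\<And>t. real (card Reps) * real (card (expos_upto v t)) \<le> real (t + D) ^ d * W"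
    using expos_bounds by blast
  have R: "1 \<le> real (card Reps)"
    using finite_Reps Reps_nonempty by (simp add: Suc_le_eq card_gt_0_iff)
  show ?thesis
  proof (intro exI[of _ "real (1 + D) ^ d * W"] allI impI)
    fix t :: nat assume t: "t \<ge> 1"
    have "real (card (expos_upto v t)) \<le> real (card Reps) * real (card (expos_upto v t))"
      using R mult_right_mono[of 1 "real (card Reps)" "real (card (expos_upto v t))"] by simp
    also have "\<dots> \<le> real (t + D) ^ d * W" by (rule up)
    also have "\<dots> \<le> real ((1 + D) * t) ^ d * W"
      using t W_nonneg by (intro mult_right_mono power_mono) (auto simp flip: of_nat_add of_nat_mult)
    finally show "real (card (expos_upto v t)) \<le> real (1 + D) ^ d * W * real t ^ d"
      by (simp only: of_nat_mult power_mult_distrib mult_ac)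
  qed
qed

end

section \<open>Torsion and the chain of primes\<close>

lemma comm_group_int_vec: "comm_group (int_vec_group :: (int ^ 'n) monoid)"
proof (rule comm_groupI)
  fix x :: "int ^ 'n" assume "x \<in> carrier int_vec_group"
  show "\<exists>y\<in>carrier int_vec_group. y \<otimes>\<^bsub>int_vec_group\<^esub> x = \<one>\<^bsub>int_vec_group\<^esub>"
    by (intro bexI[of _ "- x"]) (auto simp: int_vec_group_def)
qed (auto simp: int_vec_group_def algebra_simps)

lemma int_vec_group_simps [simp]:
  "carrier int_vec_group = UNIV"
  "x \<otimes>\<^bsub>int_vec_group\<^esub> y = x + y"
  "\<one>\<^bsub>int_vec_group\<^esub> = 0"
  by (auto simp: int_vec_group_def)

lemma int_vec_group_inv: "inv\<^bsub>int_vec_group\<^esub> x = - (x :: int ^ 'n)"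
proof -
  interpret comm_group "int_vec_group :: (int ^ 'n) monoid" by (rule comm_group_int_vec)
  show ?thesis using inv_unique'[of x "- x"] by simp
qed

lemma int_vec_group_pow: "x [^]\<^bsub>int_vec_group\<^esub> (m::nat) = int m *s (x :: int ^ 'n)"
proof -
  interpret comm_group "int_vec_group :: (int ^ 'n) monoid" by (rule comm_group_int_vec)
  show ?thesis by (induction m) (auto simp: vec_eq_iff algebra_simps)
qed

context lattice_vectors
begin

lemma generate_eq_G: "generate int_vec_group (range v) = G"
proof -
  interpret Z: comm_group "int_vec_group :: (int ^ 'n) monoid" by (rule comm_group_int_vec)
  have v: "v i = icomb (\<lambda>j. if j = i then 1 else 0)" for i
    by (simp add: icomb_def if_distribR if_distrib[of "\<lambda>c. c *s _"] cong: if_cong)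
  then have vG: "v i \<in> G" for i unfolding G_def by blast
  have sub: "subgroup (generate int_vec_group (range v)) int_vec_group"
    by (rule Z.generate_is_subgroup) simp
  show ?thesis
  proof
    show "generate int_vec_group (range v) \<subseteq> G"
    proof
      fix x assume "x \<in> generate int_vec_group (range v)"
      then show "x \<in> G"
      proof induction
        case (inv h)
        then have "0 - h \<in> G" using vG by (intro G_closed) auto
        then show ?case by (simp add: int_vec_group_inv)
      qed (use G_closed vG in auto)
    qed
    have gen_smult: "c *s v i \<in> generate int_vec_group (range v)" for c i
    proof (rule subgroup_smult_closed)
      show "0 \<in> generate int_vec_group (range v)"
        using generate.one[of int_vec_group "range v"] by simp
      show "v i \<in> generate int_vec_group (range v)" by (intro generate.incl) simp
      fix x y assume "x \<in> generate int_vec_group (range v)" "y \<in> generate int_vec_group (range v)"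
      then have "x \<otimes>\<^bsub>int_vec_group\<^esub> inv\<^bsub>int_vec_group\<^esub> y \<in> generate int_vec_group (range v)"
        using sub by (intro subgroup.m_closed subgroup.m_inv_closed)
      then show "x - y \<in> generate int_vec_group (range v)" by (simp add: int_vec_group_inv)
    qed
    have "(\<Sum>i\<in>A. z i *s v i) \<in> generate int_vec_group (range v)" if "finite A" for A z
      using that
    proof (induction A rule: finite_induct)
      case empty
      then show ?case using generate.one[of int_vec_group "range v"] by simp
    next
      case (insert i A)
      then show ?case using generate.eng[OF gen_smult[of "z i" i] insert.IH] by simp
    qed
    then show "G \<subseteq> generate int_vec_group (range v)" by (auto simp: G_def icomb_def)
  qed
qed

text \<open>By the pigeonhole principle two multiples of \<open>x\<close> share a representative, so
  their difference, again a multiple of \<open>x\<close>, lies in \<open>G\<close>. Conversely, the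
  real span allows division by \<open>m\<close>.\<close>

lemma mem_L_iff_torsion: "x \<in> L \<longleftrightarrow> (\<exists>m::nat. m > 0 \<and> int m *s x \<in> G)"
proof
  assume x: "x \<in> L"
  have sL: "int k *s x \<in> L" for k
    by (rule subgroup_smult_closed[OF L_closed(1) L_closed(3) x])
  have "\<not> inj (\<lambda>k. rep (int k *s x))"
  proof
    assume "inj (\<lambda>k. rep (int k *s x))"
    moreover have "range (\<lambda>k. rep (int k *s x)) \<subseteq> Reps" using sL by (auto simp: Reps_def)
    ultimately show False using finite_Reps finite_imageD finite_subset infinite_UNIV_nat by metis
  qed
  then obtain i j where ij: "i < j" "rep (int i *s x) = rep (int j *s x)"
    unfolding inj_def by (metis linorder_neqE_nat)
  have "(int j *s x - rep (int j *s x)) - (int i *s x - rep (int i *s x)) \<in> G"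
    by (intro G_closed(3) rep sL)
  moreover have "(int j *s x - rep (int j *s x)) - (int i *s x - rep (int i *s x)) = int (j - i) *s x"
    using ij by (simp add: vec_eq_iff algebra_simps of_nat_diff)
  ultimately show "\<exists>m::nat. m > 0 \<and> int m *s x \<in> G" using ij(1) by (intro exI[of _ "j - i"]) auto
next
  assume "\<exists>m::nat. m > 0 \<and> int m *s x \<in> G"
  then obtain m :: nat where m: "m > 0" "int m *s x \<in> G" by blast
  then have "real m *\<^sub>R real_vec x \<in> V"
    using G_subset_L by (auto simp: L_def real_vec_smult)
  then have "(1 / real m) *\<^sub>R (real m *\<^sub>R real_vec x) \<in> V" by (rule V_closed)
  then show "x \<in> L" using m by (simp add: L_def)
qed

text \<open>The torsion cosets are exactly those of elements of \<open>L\<close>, and each contains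
  exactly one element of \<open>Reps\<close>.\<close>

lemma card_torsion_part:
  "card (torsion_part (int_vec_group Mod generate int_vec_group (range v))) = card Reps"
  unfolding generate_eq_G
proof -
  interpret Z: comm_group "int_vec_group :: (int ^ 'n) monoid" by (rule comm_group_int_vec)
  let ?Z = "int_vec_group :: (int ^ 'n) monoid"
  have subG: "subgroup G ?Z"
    using Z.generate_is_subgroup[of "range v"] generate_eq_G by simp
  then interpret N: normal G ?Z by (rule Z.subgroup_imp_normal)
  let ?c = "\<lambda>x. G #>\<^bsub>?Z\<^esub> x"
  have coset: "?c x = (\<lambda>h. h + x) ` G" for x by (auto simp: r_coset_def)
  have coset_eq: "?c x = ?c y \<longleftrightarrow> x - y \<in> G" for x y
  proof
    assume "?c x = ?c y"
    moreover have "x \<in> ?c x" unfolding coset using G_closed(1) by (intro image_eqI[of _ _ 0]) auto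
    ultimately show "x - y \<in> G" unfolding coset by auto
  next
    have sub: "?c x \<subseteq> ?c y" if "x - y \<in> G" for x y
    proof
      fix z assume "z \<in> ?c x"
      then obtain h where "h \<in> G" "z = h + x" unfolding coset by auto
      then show "z \<in> ?c y" unfolding coset using G_closed(2)[OF _ that, of h]
        by (intro image_eqI[of _ _ "h + (x - y)"]) auto
    qed
    assume "x - y \<in> G"
    moreover from this have "y - x \<in> G" using G_closed(3)[OF G_closed(1), of "x - y"] by simp
    ultimately show "?c x = ?c y" using sub by blast
  qed
  interpret h: group_hom ?Z "?Z Mod G" ?c
    by (intro group_hom.intro group_hom_axioms.intro Z.is_group N.factorgroup_is_group N.r_coset_hom_Mod)
  have one: "\<one>\<^bsub>?Z Mod G\<^esub> = ?c 0"
    using h.hom_one by simp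
  have "torsion_part (?Z Mod G) = ?c ` L"
  proof -
    have "?c x [^]\<^bsub>?Z Mod G\<^esub> m = \<one>\<^bsub>?Z Mod G\<^esub> \<longleftrightarrow> int m *s x \<in> G" for x and m :: nat
      using h.hom_nat_pow[of x m] coset_eq[of "int m *s x" 0] one by (simp add: int_vec_group_pow)
    moreover have "carrier (?Z Mod G) = range ?c" by (auto simp: FactGroup_def RCOSETS_def)
    ultimately show ?thesis
      unfolding torsion_part_def by (auto simp: mem_L_iff_torsion intro!: image_eqI[OF refl])
  qed
  also have "\<dots> = ?c ` Reps"
  proof
    show "?c ` L \<subseteq> ?c ` Reps"
    proof
      fix y assume "y \<in> ?c ` L"
      then obtain x where x: "x \<in> L" "y = ?c x" by blast
      then have "y = ?c (rep x)" using rep(2) coset_eq by blast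
      then show "y \<in> ?c ` Reps" using x by (auto simp: Reps_def)
    qed
  qed (use Reps_subset_L in blast)
  finally show "card (torsion_part (?Z Mod G)) = card Reps"
    using Reps_inj by (simp add: card_image inj_on_def coset_eq)
qed

section \<open>A chain of primes over the toric ideal\<close>

text \<open>The values are finitely supported functions because these form a linearly ordered group, over
  which the monoid algebra is an integral domain.\<close>

definition coords :: "nat \<Rightarrow> int ^ 'n \<Rightarrow> nat \<Rightarrow>\<^sub>0 int" where
  "coords k x = (\<Sum>l<k. Poly_Mapping.single l (coord x l))"

lemma lookup_coords: "Poly_Mapping.lookup (coords k x) l = (if l < k then coord x l else 0)"
  by (simp add: coords_def lookup_sum lookup_single when_def)

lemma expo_in_L: "expo v m \<in> L"
  using G_subset_L by (auto simp: G_def expo_eq_icomb)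

lemma coords_expo_add:
  "k \<le> d \<Longrightarrow> coords k (expo v (x + y)) = coords k (expo v x) + coords k (expo v y)"
  by (intro poly_mapping_eqI) (simp add: lookup_coords lookup_add expo_add coord_add expo_in_L)

lemma coords_expo_0: "k \<le> d \<Longrightarrow> coords k (expo v 0) = 0"
  using coords_expo_add[of k 0 0] by simp

text \<open>The kernel of the map to the group algebra of \<open>Z^k\<close> given by the first
  \<open>k\<close> lattice coordinates; for smaller \<open>k\<close> more is forgotten and the
  kernel grows.\<close>

definition coord_ideal :: "nat \<Rightarrow> ('s, 'k::field) mpoly set" where
  "coord_ideal k = {f. push (\<lambda>m. coords k (expo v m)) f = 0}"

lemma primeideal_coord_ideal:
  assumes "k \<le> d"
  shows "primeideal (coord_ideal k :: ('s, 'k::field) mpoly set) ring_of_type_algebra"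
  unfolding coord_ideal_def
proof (rule primeideal_kernel)
  show "push (\<lambda>m. coords k (expo v m)) (1 :: ('s, 'k) mpoly) = 1"
    using coords_expo_0[OF assms] by (simp flip: single_one)
qed (simp_all add: push_add push_mult coords_expo_add[OF assms])

text \<open>A vector of \<open>L\<close> is recovered from all \<open>d\<close> coordinates by
  \<open>?\<rho>\<close>, so each of the two maps factors through the other.\<close>

lemma coord_ideal_d: "coord_ideal d = (toric_ideal v :: ('s, 'k::field) mpoly set)"
proof -
  let ?\<rho> = "\<lambda>p. \<Sum>i<d. Poly_Mapping.lookup p i *s b i"
  have "?\<rho> (coords d (expo v m)) = expo v m" for m
    using coord[OF expo_in_L[of m]] by (simp add: lookup_coords)
  then have eq: "push (expo v) f = push ?\<rho> (push (\<lambda>m. coords d (expo v m)) f)" for f :: "('s, 'k) mpoly"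
    by (simp add: push_push o_def)
  have eq': "push (\<lambda>m. coords d (expo v m)) f = push (coords d) (push (expo v) f)" for f :: "('s, 'k) mpoly"
    by (simp add: push_push o_def)
  show ?thesis
  proof (intro subset_antisym subsetI)
    fix f :: "('s, 'k) mpoly"
    show "f \<in> toric_ideal v" if "f \<in> coord_ideal d"
      using that eq[of f] by (simp add: coord_ideal_def mem_toric_ideal)
    show "f \<in> coord_ideal d" if "f \<in> toric_ideal v"
      using that eq'[of f] by (simp add: coord_ideal_def mem_toric_ideal)
  qed
qed

text \<open>The map for \<open>k\<close> is the map for \<open>k'\<close> followed by
  truncation.\<close>

lemma coord_ideal_antimono:
  assumes "k \<le> k'"
  shows "coord_ideal k' \<subseteq> (coord_ideal k :: ('s, 'k::field) mpoly set)"
proof -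
  let ?t = "\<lambda>p. \<Sum>l<k. Poly_Mapping.single l (Poly_Mapping.lookup p l)"
  have "?t (coords k' x) = coords k x" for x
    unfolding coords_def[of k] using assms by (intro sum.cong) (auto simp: lookup_coords)
  then have "push (\<lambda>m. coords k (expo v m)) f = push ?t (push (\<lambda>m. coords k' (expo v m)) f)"
    for f :: "('s, 'k) mpoly"
    by (simp add: push_push o_def)
  then show ?thesis by (auto simp: coord_ideal_def)
qed

text \<open>Some positive multiple of \<open>b k\<close> lies in \<open>G\<close>, hence is a
  difference of the exponents of two monomials. The binomial formed by these monomials is killed by
  the first \<open>k\<close> coordinates but not by the first \<open>k + 1\<close>.\<close>

lemma coord_ideal_strict:
  assumes "k < d"
  shows "coord_ideal (Suc k) \<subset> (coord_ideal k :: ('s, 'k::field) mpoly set)"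
proof -
  obtain m :: nat where m: "m > 0" "int m *s b k \<in> G"
    using mem_L_iff_torsion b_in_L[OF assms] by blast
  then obtain z where z: "int m *s b k = icomb z" by (auto simp: G_def)
  \<comment> \<open>Positive and negative parts of the integer coefficients
    \<open>z\<close>.\<close>
  let ?a = "Abs_poly_mapping (\<lambda>i. nat (z i))" and ?c = "Abs_poly_mapping (\<lambda>i. nat (- z i))"
  have "icomb z + expo v ?c = expo v ?a"
    unfolding expo_eq_icomb icomb_add by (intro arg_cong[of _ _ icomb]) (auto simp: fun_eq_iff)
  then have a: "expo v ?a = int m *s b k + expo v ?c" by (simp add: z)
  have "int m *s b k = (\<Sum>i<d. (if i = k then int m else 0) *s b i)"
    using assms by (simp add: if_distribR if_distrib[of "\<lambda>c. c *s _"] cong: if_cong)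
  from coord_unique[OF this] have cfb: "coord (int m *s b k) l = (if l = k then int m else 0)" if "l < d" for l
    using that by simp
  have mL: "int m *s b k \<in> L" using m G_subset_L by blast
  have cf_a: "coord (expo v ?a) l = (if l = k then int m else 0) + coord (expo v ?c) l" if "l < d" for l
    unfolding a using coord_add[OF mL expo_in_L that] cfb[OF that] by simp
  let ?f = "Poly_Mapping.single ?a 1 - Poly_Mapping.single ?c 1 :: ('s, 'k) mpoly"
  have "coords k (expo v ?a) = coords k (expo v ?c)"
    using assms cf_a by (intro poly_mapping_eqI) (auto simp: lookup_coords)
  then have "?f \<in> coord_ideal k" by (simp add: coord_ideal_def push_diff)
  moreover have "?f \<notin> coord_ideal (Suc k)"
  proof
    assume "?f \<in> coord_ideal (Suc k)"
    then have "Poly_Mapping.single (coords (Suc k) (expo v ?a)) (1::'k)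
        = Poly_Mapping.single (coords (Suc k) (expo v ?c)) 1"
      by (simp add: coord_ideal_def push_diff)
    then have "coords (Suc k) (expo v ?a) = coords (Suc k) (expo v ?c)"
      by (rule inj_onD[OF inj_single_one]) (rule UNIV_I)+
    then have "Poly_Mapping.lookup (coords (Suc k) (expo v ?a)) k
        = Poly_Mapping.lookup (coords (Suc k) (expo v ?c)) k" by simp
    then show False using cf_a[OF assms] m(1) by (simp add: lookup_coords)
  qed
  ultimately show ?thesis using coord_ideal_antimono[of k "Suc k"] by auto
qed

section \<open>Krull dimension and degree\<close>

lemma krull_dim_toric:
  "krull_dim (ring_of_type_algebra Quot (toric_ideal v :: ('s, 'k::field) mpoly set)) = enat d"
proof -
  let ?R = "ring_of_type_algebra :: ('s, 'k) mpoly ring"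
  interpret R: cring ?R by (rule cring_from_type_algebra)
  let ?P = "toric_ideal v :: ('s, 'k) mpoly set"
  have P_eq: "coord_ideal d = ?P" by (rule coord_ideal_d)
  have prime: "primeideal (coord_ideal k) ?R" if "k \<le> d" for k
    by (rule primeideal_coord_ideal[OF that])
  have P: "ideal ?P ?R"
    using prime[of d] P_eq by (simp add: primeideal_def)
  let ?A = "{enat m | m. \<exists>Q. (\<forall>i\<le>m. primeideal (Q i) ?R \<and> ?P \<subseteq> Q i) \<and> (\<forall>i<m. Q i \<subset> Q (Suc i))}"
  have "Sup ?A = enat d"
  proof (rule Sup_eqI)
    obtain C where C: "\<And>t. t \<ge> 1 \<Longrightarrow> real (card (expos_upto v t)) \<le> C * real t ^ d"
      using expos_growth by blast
    fix y assume "y \<in> ?A"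
    then obtain m Q where "y = enat m" "\<forall>i\<le>m. primeideal (Q i) ?R \<and> ?P \<subseteq> Q i" "\<forall>i<m. Q i \<subset> Q (Suc i)"
      by blast
    then show "y \<le> enat d"
      using prime_chain_length_le[OF C, of m Q] by simp
  next
    fix y assume y: "\<And>z. z \<in> ?A \<Longrightarrow> z \<le> y"
    \<comment> \<open>The reversed index makes the chain ascend, starting from the toric
      ideal.\<close>
    let ?Q = "\<lambda>i. coord_ideal (d - i) :: ('s, 'k) mpoly set"
    have "?P \<subseteq> ?Q i" for i
      using coord_ideal_antimono[of "d - i" d, where ?'k = 'k] P_eq by simp
    moreover have "?Q i \<subset> ?Q (Suc i)" if "i < d" for i
      using coord_ideal_strict[of "d - Suc i", where ?'k = 'k] that by (simp add: Suc_diff_Suc)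
    ultimately have "enat d \<in> ?A"
      using prime by (intro CollectI exI[of _ d] exI[of _ ?Q] conjI allI impI refl) auto
    then show "enat d \<le> y" by (rule y)
  qed
  then show ?thesis by (simp only: R.krull_dim_quot[OF P])
qed

lemma deg_quot_toric:
  "real (card Reps) * deg_quot (toric_ideal v :: ('s, 'k::field) mpoly set) = fact d * W"
proof -
  have R: "card Reps > 0" using finite_Reps Reps_nonempty by (simp add: card_gt_0_iff)
  have "(\<lambda>t. (real (card Reps) * real (card (expos_upto v t)) / real t ^ d) / real (card Reps))
      \<longlonglongrightarrow> W / real (card Reps)"
    by (intro tendsto_divide expos_limit tendsto_const) (use R in simp)
  then have "(\<lambda>t. real (card (expos_upto v t)) / real t ^ d) \<longlonglongrightarrow> W / real (card Reps)"
    using R by simp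
  then have "lim (\<lambda>t. real (card (expos_upto v t)) / real t ^ d) = W / real (card Reps)"
    by (rule limI)
  then show ?thesis
    using R by (simp add: deg_quot_def krull_dim_toric quot_dim_toric)
qed

section \<open>Rank, lattice frames and relative volume\<close>

lemma dim_V: "dim (range (\<lambda>i. real_vec (v i))) = d"
proof -
  let ?B = "(\<lambda>i. real_vec (b i)) ` {..<d}"
  have inj: "inj_on (\<lambda>i. real_vec (b i)) {..<d}"
  proof (rule inj_onI, rule ccontr)
    fix i j assume ij: "i \<in> {..<d}" "j \<in> {..<d}" "real_vec (b i) = real_vec (b j)" "i \<noteq> j"
    have "(\<Sum>l<d. (if l = i then 1 else 0) *\<^sub>R real_vec (b l)) = (\<Sum>l<d. (if l = j then 1 else 0) *\<^sub>R real_vec (b l))"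
      using ij by (simp add: if_distribR if_distrib[of "\<lambda>c. c *\<^sub>R _"] cong: if_cong)
    from basis_unique[OF this, of i] show False using ij by simp
  qed
  have "independent ?B"
  proof (rule independent_if_scalars_zero)
    fix f x assume "(\<Sum>x\<in>?B. f x *\<^sub>R x) = 0" "x \<in> ?B"
    then show "f x = 0"
      using basis_indep[of "\<lambda>i. f (real_vec (b i))"] by (auto simp: sum.reindex[OF inj])
  qed simp
  moreover have "?B \<subseteq> span (range (\<lambda>i. real_vec (v i)))" using basis_in by auto
  moreover have "span (range (\<lambda>i. real_vec (v i))) \<subseteq> span ?B"
  proof (rule span_minimal)
    show "range (\<lambda>i. real_vec (v i)) \<subseteq> span ?B"
    proof (rule image_subsetI)
      fix i
      obtain c where "v i = (\<Sum>l<d. c l *s b l)"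
        using basis_gen[of "v i"] by (auto intro: span_base)
      then have "real_vec (v i) = (\<Sum>l<d. real_of_int (c l) *\<^sub>R real_vec (b l))"
        by (simp add: real_vec_sum real_vec_smult)
      also have "\<dots> \<in> span ?B" by (intro span_sum span_scale span_base) auto
      finally show "real_vec (v i) \<in> span ?B" .
    qed
  qed (rule subspace_span)
  moreover have "card ?B = d" by (simp add: card_image inj)
  ultimately have "dim (span (range (\<lambda>i. real_vec (v i)))) = d" by (intro dim_unique)
  then show ?thesis by simp
qed

abbreviation lattice_polytope :: "(real ^ 'n) set" where
  "lattice_polytope \<equiv> convex hull (insert 0 (range (\<lambda>i. real_vec (v i))))"

lemma affine_hull_polytope: "affine hull lattice_polytope = V"
  unfolding affine_hull_convex_hull V_def
  \<comment> \<open>The polytope contains 0, so its affine hull is a linear span.\<close>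
  by (subst affine_hull_span_0) (auto intro: hull_inc)

lemma aff_dim_polytope: "aff_dim lattice_polytope = int d"
proof -
  have "dim (insert 0 (range (\<lambda>i. real_vec (v i)))) = d"
    using dim_V by (metis dim_span span_insert_0)
  then show ?thesis by (simp add: aff_dim_convex_hull aff_dim_zero hull_inc)
qed

lemma phi_in_V: "\<phi> c \<in> V"
  unfolding \<phi>_def V_def using basis_in by (auto intro!: span_sum span_scale)

lemma V_subset_phi:
  assumes "x \<in> V"
  shows "\<exists>c\<in>{..<d} \<rightarrow>\<^sub>E UNIV. x = \<phi> c"
proof -
  have "V \<subseteq> range \<phi>"
    unfolding V_def
  proof (rule span_minimal)
    have "real_vec (v i) = \<phi> (\<lambda>j. real_of_int (coord (v i) j))" for i
      by (intro real_vec_coord) (auto simp: L_def V_def intro: span_base)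
    then show "range (\<lambda>i. real_vec (v i)) \<subseteq> range \<phi>" by blast
    have zero: "0 = \<phi> (\<lambda>_. 0)" by (simp add: \<phi>_def)
    show "subspace (range \<phi>)"
    proof (intro subspaceI)
      fix x y and k :: real assume "x \<in> range \<phi>" "y \<in> range \<phi>"
      then obtain c c' where c: "x = \<phi> c" "y = \<phi> c'" by blast
      show "x + y \<in> range \<phi>" unfolding c phi_add[symmetric] by (rule rangeI)
      show "k *\<^sub>R x \<in> range \<phi>" unfolding c phi_scale[symmetric] by (rule rangeI)
    qed (subst zero, rule rangeI)
  qed
  then obtain c where "x = \<phi> c" using assms by blast
  also have "\<dots> = \<phi> (restrict c {..<d})" by (intro phi_cong) simp
  finally show ?thesis by (intro bexI[of _ "restrict c {..<d}"]) (auto simp: restrict_PiE_iff)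
qed

lemma frame_of_basis: "lattice_frame lattice_polytope d 0 (\<lambda>i. real_vec (b i))"
proof -
  have co: "affine_coords d 0 (\<lambda>i. real_vec (b i)) = \<phi>"
    by (simp add: fun_eq_iff affine_coords_def \<phi>_def)
  show ?thesis
    unfolding lattice_frame_def co affine_hull_polytope
  proof
    show "bij_betw \<phi> ({..<d} \<rightarrow>\<^sub>E UNIV) V"
      unfolding bij_betw_def
    proof
      show "inj_on \<phi> ({..<d} \<rightarrow>\<^sub>E UNIV)"
        by (rule inj_onI, rule PiE_ext) (auto simp: \<phi>_def intro: basis_unique)
      show "\<phi> ` ({..<d} \<rightarrow>\<^sub>E UNIV) = V" using phi_in_V V_subset_phi by blast
    qed
    show "\<phi> ` ({..<d} \<rightarrow>\<^sub>E \<int>) = V \<inter> range real_vec"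
    proof
      show "\<phi> ` ({..<d} \<rightarrow>\<^sub>E \<int>) \<subseteq> V \<inter> range real_vec"
      proof (rule image_subsetI)
        fix c assume c: "c \<in> {..<d} \<rightarrow>\<^sub>E (\<int> :: real set)"
        have "real_of_int \<lfloor>c i\<rfloor> = c i" if "i < d" for i
          using PiE_mem[OF c, of i] that by (auto elim: Ints_cases)
        then have "\<phi> c = real_vec (\<Sum>i<d. \<lfloor>c i\<rfloor> *s b i)"
          unfolding \<phi>_def real_vec_sum real_vec_smult by (intro sum.cong refl) (metis lessThan_iff)
        then show "\<phi> c \<in> V \<inter> range real_vec" using phi_in_V[of c] by blast
      qed
      show "V \<inter> range real_vec \<subseteq> \<phi> ` ({..<d} \<rightarrow>\<^sub>E \<int>)"
      proof
        fix y assume "y \<in> V \<inter> range real_vec"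
        then obtain x where x: "x \<in> L" "y = real_vec x" by (auto simp: L_def)
        have "y = \<phi> (\<lambda>i\<in>{..<d}. real_of_int (coord x i))"
          unfolding x(2) real_vec_coord[OF x(1)] by (intro phi_cong) simp
        moreover have "(\<lambda>i\<in>{..<d}. real_of_int (coord x i)) \<in> {..<d} \<rightarrow>\<^sub>E \<int>"
          by (simp add: restrict_PiE_iff)
        ultimately show "y \<in> \<phi> ` ({..<d} \<rightarrow>\<^sub>E \<int>)" by (rule image_eqI)
      qed
    qed
  qed
qed

text \<open>An origin in \<open>V\<close> is of the form \<open>\<phi> q\<close>, so it only
  translates the body in coordinates.\<close>

lemma measure_polytope_in_frame:
  assumes "p \<in> V"
  shows "measure leb {c \<in> {..<d} \<rightarrow>\<^sub>E UNIV. affine_coords d p (\<lambda>i. real_vec (b i)) c \<in> lattice_polytope} = W"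
proof -
  obtain q where q: "p = \<phi> q" using V_subset_phi[OF assms] by blast
  have "affine_coords d p (\<lambda>i. real_vec (b i)) c = \<phi> q + \<phi> c" for c
    by (simp add: affine_coords_def q \<phi>_def)
  then show ?thesis
    using emeasure_body_translate[of q] by (simp add: W_def measure_def T_1)
qed

end

lemma lattice_vectors_exists:
  fixes v :: "'s::finite \<Rightarrow> int ^ 'n"
  shows "\<exists>d b. lattice_vectors v d b"
proof -
  let ?V = "span (range (\<lambda>i. real_vec (v i)))"
  have "\<exists>d b. (\<forall>i<d. b i \<in> {x. real_vec x \<in> ?V}) \<and> (\<forall>x\<in>{x. real_vec x \<in> ?V}. \<exists>c. x = (\<Sum>i<d. c i *s b i)) \<and>
     (\<forall>c. (\<Sum>i<d. c i *\<^sub>R real_vec (b i)) = 0 \<longrightarrow> (\<forall>i<(d::nat). c i = 0))"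
    by (rule subgroup_basis[where J = UNIV]) (auto simp: span_zero real_vec_diff span_diff)
  then show ?thesis unfolding lattice_vectors_def by blast
qed

text \<open>Since \<open>rel_vol\<close> uses an unspecified frame, any frame has to be handled: its
  axes form a lattice basis, to which the whole theory above then applies, and its origin lies in
  the span.\<close>

lemma lattice_vectors_of_frame:
  fixes v :: "'s::finite \<Rightarrow> int ^ 'n"
  assumes frame: "lattice_frame (convex hull (insert 0 (range (\<lambda>i. real_vec (v i))))) d p c"
  shows "\<exists>b. lattice_vectors v d b \<and> (\<forall>i<d. c i = real_vec (b i))"
    and "p \<in> span (range (\<lambda>i. real_vec (v i)))"
proof -
  let ?V = "span (range (\<lambda>i. real_vec (v i)))"
  obtain d' b' where "lattice_vectors v d' b'" using lattice_vectors_exists by blast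
  then interpret l: lattice_vectors v d' b' .
  have V: "affine hull l.lattice_polytope = ?V" using l.affine_hull_polytope by (simp add: l.V_def)
  have bij: "bij_betw (affine_coords d p c) ({..<d} \<rightarrow>\<^sub>E UNIV) ?V"
    and ints: "affine_coords d p c ` ({..<d} \<rightarrow>\<^sub>E \<int>) = ?V \<inter> range real_vec"
    using frame unfolding lattice_frame_def V by auto
  \<comment> \<open>The origin of coordinate space is an integer point, so \<open>p\<close> is a
    lattice point.\<close>
  have 0: "affine_coords d p c (\<lambda>i\<in>{..<d}. 0) = p" by (simp add: affine_coords_def)
  have "affine_coords d p c (\<lambda>i\<in>{..<d}. 0) \<in> affine_coords d p c ` ({..<d} \<rightarrow>\<^sub>E \<int>)"
    by (intro imageI, subst restrict_PiE_iff) simp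
  then have p: "p \<in> ?V" "p \<in> range real_vec" using ints by (auto simp: 0)
  then show "p \<in> ?V" by blast
  obtain p0 where p0: "p = real_vec p0" using p by blast
  have c: "c i \<in> ?V \<inter> range real_vec" if "i < d" for i
  proof -
    \<comment> \<open>A unit vector is sent to \<open>p + c i\<close>; subtracting the lattice point
      \<open>p\<close> shows that the axis is integral.\<close>
    let ?e = "\<lambda>j\<in>{..<d}. if j = i then 1 else (0::real)"
    have "affine_coords d p c ?e = p + c i"
      using that by (simp add: affine_coords_def if_distribR if_distrib[of "\<lambda>k. k *\<^sub>R _"] cong: if_cong)
    moreover have "affine_coords d p c ?e \<in> affine_coords d p c ` ({..<d} \<rightarrow>\<^sub>E \<int>)"
      by (intro imageI, subst restrict_PiE_iff) simp
    ultimately have pc: "p + c i \<in> ?V" "p + c i \<in> range real_vec" using ints by auto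
    then obtain x where "p + c i = real_vec x" by blast
    then have "c i = real_vec (x - p0)" by (simp add: real_vec_diff p0 algebra_simps)
    moreover have "c i \<in> ?V" using span_diff[OF pc(1) p(1)] by simp
    ultimately show ?thesis by blast
  qed
  then have "\<forall>i. \<exists>x. i < d \<longrightarrow> c i = real_vec x" by blast
  then obtain b where b: "\<And>i. i < d \<Longrightarrow> c i = real_vec (b i)" by metis
  have "lattice_vectors v d b"
  proof
    show "real_vec (b i) \<in> ?V" if "i < d" for i using c[OF that] b[OF that] by simp
    show "\<exists>z. x = (\<Sum>i<d. z i *s b i)" if "real_vec x \<in> ?V" for x
    proof -
      \<comment> \<open>The frame parametrizes the lattice from \<open>p\<close>, so the coordinates
        of \<open>x\<close> are those of the shifted point.\<close>
      have "p + real_vec x \<in> ?V \<inter> range real_vec"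
        using span_add[OF p(1) that] by (auto simp: p0 simp flip: real_vec_add)
      then obtain k where k: "k \<in> {..<d} \<rightarrow>\<^sub>E \<int>" "p + real_vec x = affine_coords d p c k"
        using ints by blast
      have ki: "real_of_int \<lfloor>k i\<rfloor> = k i" if "i < d" for i
        using PiE_mem[OF k(1), of i] that by (auto elim: Ints_cases)
      have "real_vec x = (\<Sum>i<d. k i *\<^sub>R c i)" using k(2) by (simp add: affine_coords_def)
      also have "\<dots> = real_vec (\<Sum>i<d. \<lfloor>k i\<rfloor> *s b i)"
        unfolding real_vec_sum real_vec_smult by (intro sum.cong refl) (metis ki b lessThan_iff)
      finally have "x = (\<Sum>i<d. \<lfloor>k i\<rfloor> *s b i)" by simp
      then show ?thesis by (intro exI[of _ "\<lambda>i. \<lfloor>k i\<rfloor>"])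
    qed
    show "k i = 0" if "(\<Sum>i<d. k i *\<^sub>R real_vec (b i)) = 0" "i < d" for k i
    proof -
      \<comment> \<open>A linear relation would give the same point as the zero coordinates, against
        injectivity of the frame.\<close>
      have "affine_coords d p c (restrict k {..<d}) = affine_coords d p c (\<lambda>i\<in>{..<d}. 0)"
        using that(1) b by (simp add: affine_coords_def)
      then have "restrict k {..<d} = (\<lambda>i\<in>{..<d}. 0)"
        by (rule inj_onD[OF bij_betw_imp_inj_on[OF bij]]) auto
      then show ?thesis using that(2) by (metis lessThan_iff restrict_apply')
    qed
  qed
  then show "\<exists>b. lattice_vectors v d b \<and> (\<forall>i<d. c i = real_vec (b i))" using b by blast
qed

theorem theorem4p5:
  fixes v :: "'s::finite \<Rightarrow> int ^ 'n"
    and A :: "real ^ 's ^ 'n"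
    and r :: nat
    and P :: "('s, 'k::field) mpoly set"
  assumes "P = toric_ideal v"
    and "A = (\<chi> i j. real_of_int (v j $ i))"
    and "r = rank A"
  shows "real (card (torsion_part (int_vec_group Mod generate int_vec_group (range v)))) * deg_quot P
           = fact r * rel_vol (convex hull (insert 0 (range (\<lambda>i. real_vec (v i)))))"
proof -
  let ?C = "convex hull (insert 0 (range (\<lambda>i. real_vec (v i))))"
  have "column j A = real_vec (v j)" for j
    by (simp add: assms(2) column_def vec_eq_iff)
  then have "columns A = range (\<lambda>i. real_vec (v i))"
    by (auto simp: columns_def)
  then have r: "r = dim (range (\<lambda>i. real_vec (v i)))"
    by (simp add: assms(3) column_rank_def)
  \<comment> \<open>An auxiliary lattice basis identifies the dimension with \<open>r\<close> and
    shows that a frame exists.\<close>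
  obtain d0 b0 where "lattice_vectors v d0 b0" using lattice_vectors_exists by blast
  then interpret l0: lattice_vectors v d0 b0 .
  have d0: "d0 = r" using l0.dim_V r by simp
  then have dim: "nat (aff_dim ?C) = r" using l0.aff_dim_polytope by simp
  obtain p c where pc: "(SOME (p, b). lattice_frame ?C r p b) = (p, c)" by fastforce
  have "\<exists>x. case x of (p, b) \<Rightarrow> lattice_frame ?C r p b"
    using l0.frame_of_basis d0 by blast
  from someI_ex[OF this] have frame: "lattice_frame ?C r p c" unfolding pc by simp
  \<comment> \<open>The second basis consists of the axes of the frame selected in
    \<open>rel_vol\<close>, so that \<open>l.W\<close> is the relative volume itself.\<close>
  obtain b where "lattice_vectors v r b" and cb: "\<And>i. i < r \<Longrightarrow> c i = real_vec (b i)"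
    using lattice_vectors_of_frame(1)[OF frame] by blast
  then interpret l: lattice_vectors v r b by blast
  have pV: "p \<in> l.V" using lattice_vectors_of_frame(2)[OF frame] by (simp add: l.V_def)
  have "affine_coords r p c = affine_coords r p (\<lambda>i. real_vec (b i))"
    by (auto simp: fun_eq_iff affine_coords_def cb)
  then have "rel_vol ?C = l.W"
    unfolding rel_vol_def Let_def dim pc using l.measure_polytope_in_frame[OF pV] by simp
  then show ?thesis
    using l.deg_quot_toric[where ?'k = 'k] by (simp add: l.card_torsion_part assms(1))
qed

end
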